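(* Let $J=\big((j_{10},j_{20}),\dots,(j_{1d},j_{2d})\big)\in(\mathbb N\times\mathbb N)^{d+1}$ be admissible uniformity dimensions. Then the dichotomy spectrum $\Sigma_J(A)$ is the nonempty union of at most $d$ compact intervals $$\Sigma_J(A)=[a_1,b_1]\cup\dots\cup[a_\ell,b_\ell],$$ where $a_1\le b_1<a_2\le b_2<\dots<a_\ell\le b_\ell$ are real and $\ell\in\{1,\dots,d\}$. Setting $b_0:=-\infty$ and $a_{\ell+1}:=\infty$, there exists a filtration $$\{0\}=M_0\subsetneq M_1\subsetneq\dots\subsetneq M_\ell=\mathbb R^d$$ of subspaces $M_k\subseteq\mathbb R^d$, $k\in\{0,\dots,\ell\}$, such that for every $k\in\{0,\dots,\ell\}$ and every $\gamma\in(b_k,a_{k+1})$ $$M_k=\big\{x_0\in\mathbb R^d:\lim_{n\to\infty}e^{-\gamma n}x(n,x_0)=0\big\}.$$ If $\mathbb T=\mathbb Z$, there exists moreover a decomposition $$\mathbb R^d=W_1\oplus\dots\oplus W_\ell$$ into subspaces $W_k\subseteq\mathbb R^d$ such that for every $k\in\{1,\dots,\ell\}$, every $\gamma_1\in(b_{k-1},a_k)$ and every $\gamma_2\in(b_k,a_{k+1})$ $$W_k=\big\{x_0\in\mathbb R^d:\lim_{n\to-\infty}e^{-\gamma_1 n}x(n,x_0)=\lim_{n\to\infty}e^{-\gamma_2 n}x(n,x_0)=0\big\}.$$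
   Context: Setting. $\mathbb N=\{0,1,2,\dots\}$, $d\in\mathbb N_{>0}$, $\mathbb T=\mathbb N$ or $\mathbb T=\mathbb Z$, and $A:\mathbb T\to\mathrm{GL}(\mathbb R^d)$ is such that $A$ and $n\mapsto A(n)^{-1}$ are bounded. Consider the system $x(n+1)=A(n)x(n)$, $n\in\mathbb T$. For $x_0\in\mathbb R^d$, $x(\cdot,x_0):\mathbb T\to\mathbb R^d$ denotes its solution with $x(0,x_0)=x_0$, i.e. $x(n,x_0)=A(n-1)\cdots A(0)x_0$ for $n>0$ and, if $\mathbb T=\mathbb Z$, $x(n,x_0)=A(n)^{-1}\cdots A(-1)^{-1}x_0$ for $n<0$. $\|\cdot\|$ is a fixed norm on $\mathbb R^d$. For $\gamma\in\mathbb R$ the $\gamma$-shifted system is $x(n+1)=e^{-\gamma}A(n)x(n)$; its solution starting at time $0$ in $x_0$ is $e^{-\gamma n}x(n,x_0)$. For a subspace $L\subseteq\mathbb R^d$, $\mathcal G_j(L)$ is the set of $j$-dimensional subspaces of $L$. A splitting of $\mathbb R^d$ is a pair $(L_1,L_2)$ of subspaces with $L_1\oplus L_2=\mathbb R^d$. Dichotomy with uniformity dimensions. For $(j_1,j_2)\in\mathbb N\times\mathbb N$, the $\gamma$-shifted system has a dichotomy on a splitting $(L_1,L_2)$ with uniformity dimensions $(j_1,j_2)$ if $\bigcup\mathcal G_{j_1}(L_1)=L_1$, $\bigcup\mathcal G_{j_2}(L_2)=L_2$, and there is $\alpha>0$ such that: for each $U_1\in\mathcal G_{j_1}(L_1)$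 there is $C(U_1)>0$ with $\|x(n,x_0)\|\le C(U_1)e^{(\gamma-\alpha)(n-m)}\|x(m,x_0)\|$ for all $m,n\in\mathbb T$, $n\ge m$, $x_0\in U_1$; and for each $U_2\in\mathcal G_{j_2}(L_2)$ there is $C(U_2)>0$ with $\|x(n,x_0)\|\ge C(U_2)e^{(\gamma+\alpha)(n-m)}\|x(m,x_0)\|$ for all $m,n\in\mathbb T$, $n\ge m$, $x_0\in U_2$. Admissibility. For $k,j_1,j_2\in\{0,\dots,d\}$, the pair $(j_1,j_2)$ is $k$-admissible if: $k=0$, $j_1=0$, $j_2\in\{1,\dots,d\}$; or $k\in\{1,\dots,d-1\}$, $j_1\in\{1,\dots,k\}$, $j_2\in\{1,\dots,d-k\}$; or $k=d$, $j_1\in\{1,\dots,d\}$, $j_2=0$. The tuple $J=\big((j_{10},j_{20}),\dots,(j_{1d},j_{2d})\big)$ is called admissible (admissible uniformity dimensions) if $(j_{1k},j_{2k})$ is $k$-admissible for every $k\in\{0,\dots,d\}$. Resolvent and spectrum. $\rho_J(A)$ is the set of $\gamma\in\mathbb R$ such that the $\gamma$-shifted system has a dichotomy on some splitting $(L_1,L_2)$ with uniformity dimensions $(j_{1k},j_{2k})$, where $k=\dim L_1$. The dichotomy spectrum is $\Sigma_J(A):=\mathbb R\setminus\rho_J(A)$. *)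

theory Defs
  imports "HOL-Analysis.Analysis"
begin

definition is_norm :: "('a::real_vector \<Rightarrow> real) \<Rightarrow> bool" where
  "is_norm N \<longleftrightarrow> (\<forall>x. 0 \<le> N x) \<and> (\<forall>x. N x = 0 \<longleftrightarrow> x = 0) \<and>
     (\<forall>c x. N (c *\<^sub>R x) = \<bar>c\<bar> * N x) \<and> (\<forall>x y. N (x + y) \<le> N x + N y)"

(* A time set T is a set of integers, either {0..} or UNIV. The coefficient function A is
   total on int; its values outside T are irrelevant. *)

(* forward_prod A n = A (n-1) ** ... ** A 0 *)
primrec forward_prod :: "(int \<Rightarrow> real^'n^'n) \<Rightarrow> nat \<Rightarrow> real^'n^'n" where
  "forward_prod A 0 = mat 1"
| "forward_prod A (Suc n) = A (int n) ** forward_prod A n"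

(* backward_prod A n = matrix_inv (A (-n)) ** ... ** matrix_inv (A (-1)) *)
primrec backward_prod :: "(int \<Rightarrow> real^'n^'n) \<Rightarrow> nat \<Rightarrow> real^'n^'n" where
  "backward_prod A 0 = mat 1"
| "backward_prod A (Suc n) = matrix_inv (A (- int (Suc n))) ** backward_prod A n"

definition sol :: "(int \<Rightarrow> real^'n^'n) \<Rightarrow> int \<Rightarrow> real^'n \<Rightarrow> real^'n" where
  "sol A n x0 = (if 0 \<le> n then forward_prod A (nat n) *v x0
                 else backward_prod A (nat (- n)) *v x0)"

lemma sol_0: "sol A 0 x0 = x0"
  by (simp add: sol_def)

lemma sol_step:
  fixes A :: "int \<Rightarrow> real^'n^'n"
  assumes "0 \<le> n \<or> invertible (A n)"
  shows "sol A (n + 1) x0 = A n *v sol A n x0"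
proof (cases "0 \<le> n")
  case True
  then show ?thesis
    by (simp add: sol_def nat_add_distrib matrix_vector_mul_assoc)
next
  case False
  define m where "m = nat (- n - 1)"
  have n: "n = - int (Suc m)" using False by (simp add: m_def)
  have inv: "A n ** matrix_inv (A n) = mat 1"
    using assms False someI_ex[of "\<lambda>B. A n ** B = mat 1 \<and> B ** A n = mat 1"]
    by (auto simp: invertible_def matrix_inv_def)
  have "sol A n x0 = backward_prod A (Suc m) *v x0"
    unfolding sol_def n by (simp del: of_nat_Suc backward_prod.simps)
  then have s: "sol A n x0 = matrix_inv (A n) *v (backward_prod A m *v x0)"
    by (simp add: n matrix_vector_mul_assoc)
  have "A n *v sol A n x0 = backward_prod A m *v x0"
    unfolding s by (simp add: matrix_vector_mul_assoc matrix_mul_assoc inv)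
  moreover have "sol A (n + 1) x0 = backward_prod A m *v x0"
  proof (cases "m = 0")
    case False
    have "nat (- (n + 1)) = m" "\<not> 0 \<le> n + 1" using False n by auto
    then show ?thesis by (simp add: sol_def)
  qed (simp add: sol_def n)
  ultimately show ?thesis by simp
qed

definition subspaces_of_dim :: "nat \<Rightarrow> ('a::euclidean_space) set \<Rightarrow> 'a set set" where
  "subspaces_of_dim j L = {U. subspace U \<and> U \<subseteq> L \<and> dim U = j}"

definition splitting :: "('a::euclidean_space) set \<Rightarrow> 'a set \<Rightarrow> bool" where
  "splitting L1 L2 \<longleftrightarrow> subspace L1 \<and> subspace L2 \<and>
     L1 \<inter> L2 = {0} \<and> {u + v | u v. u \<in> L1 \<and> v \<in> L2} = UNIV"

definition has_dichotomy ::
  "int set \<Rightarrow> (real^'n \<Rightarrow> real) \<Rightarrow> (int \<Rightarrow> real^'n^'n) \<Rightarrow> real \<Rightarrow>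
   (real^'n) set \<Rightarrow> (real^'n) set \<Rightarrow> nat \<times> nat \<Rightarrow> bool" where
  "has_dichotomy T N A \<gamma> L1 L2 j \<longleftrightarrow>
     \<Union>(subspaces_of_dim (fst j) L1) = L1 \<and>
     \<Union>(subspaces_of_dim (snd j) L2) = L2 \<and>
     (\<exists>\<alpha>>0.
       (\<forall>U \<in> subspaces_of_dim (fst j) L1. \<exists>C>0. \<forall>m\<in>T. \<forall>n\<in>T. \<forall>x0\<in>U. m \<le> n \<longrightarrow>
          N (sol A n x0) \<le> C * exp ((\<gamma> - \<alpha>) * real_of_int (n - m)) * N (sol A m x0)) \<and>
       (\<forall>U \<in> subspaces_of_dim (snd j) L2. \<exists>C>0. \<forall>m\<in>T. \<forall>n\<in>T. \<forall>x0\<in>U. m \<le> n \<longrightarrow>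
          N (sol A n x0) \<ge> C * exp ((\<gamma> + \<alpha>) * real_of_int (n - m)) * N (sol A m x0)))"

definition k_admissible :: "nat \<Rightarrow> nat \<Rightarrow> nat \<times> nat \<Rightarrow> bool" where
  "k_admissible d k j \<longleftrightarrow>
     (k = 0 \<and> fst j = 0 \<and> snd j \<in> {1..d}) \<or>
     (1 \<le> k \<and> k < d \<and> fst j \<in> {1..k} \<and> snd j \<in> {1..d - k}) \<or>
     (k = d \<and> fst j \<in> {1..d} \<and> snd j = 0)"

(* A tuple (J 0, ..., J d) is a function on nat of which only the values at 0, ..., d matter. *)
definition admissible :: "nat \<Rightarrow> (nat \<Rightarrow> nat \<times> nat) \<Rightarrow> bool" where
  "admissible d J \<longleftrightarrow> (\<forall>k\<le>d. k_admissible d k (J k))"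

definition resolvent ::
  "int set \<Rightarrow> (real^'n \<Rightarrow> real) \<Rightarrow> (int \<Rightarrow> real^'n^'n) \<Rightarrow> (nat \<Rightarrow> nat \<times> nat) \<Rightarrow> real set" where
  "resolvent T N A J =
     {\<gamma>. \<exists>L1 L2. splitting L1 L2 \<and> has_dichotomy T N A \<gamma> L1 L2 (J (dim L1))}"

definition dichotomy_spectrum ::
  "int set \<Rightarrow> (real^'n \<Rightarrow> real) \<Rightarrow> (int \<Rightarrow> real^'n^'n) \<Rightarrow> (nat \<Rightarrow> nat \<times> nat) \<Rightarrow> real set" where
  "dichotomy_spectrum T N A J = - resolvent T N A J"

(* The open interval (b k, a (k+1)), with the conventions b 0 = -\<infinity> and a (l+1) = \<infinity>;
   the values b 0 and a (l+1) of the functions themselves are not used. *)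
definition gap :: "nat \<Rightarrow> (nat \<Rightarrow> real) \<Rightarrow> (nat \<Rightarrow> real) \<Rightarrow> nat \<Rightarrow> real set" where
  "gap l a b k =
     {\<gamma>. (if k = 0 then - \<infinity> else ereal (b k)) < ereal \<gamma> \<and>
         ereal \<gamma> < (if k = l then \<infinity> else ereal (a (k + 1)))}"

definition direct_sum_decomposition :: "'i set \<Rightarrow> ('i \<Rightarrow> ('a::real_vector) set) \<Rightarrow> bool" where
  "direct_sum_decomposition I W \<longleftrightarrow>
     (\<forall>i\<in>I. subspace (W i)) \<and> (\<forall>x. \<exists>!w. w \<in> (\<Pi>\<^sub>E i\<in>I. W i) \<and> x = (\<Sum>i\<in>I. w i))"

end

theory Submission
  imports Defs
begin

text \<open>
  For \<open>\<gamma>\<close> in the resolvent, with a dichotomy on \<open>(L\<^sub>1, L\<^sub>2)\<close>, the space \<open>L\<^sub>1\<close> is forced: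
  it consists of the initial values whose \<open>\<gamma>\<close>-shifted solution tends to \<open>0\<close> at \<open>\<infinity>\<close>
  (the stable space \<open>S \<gamma>\<close>). The constants of the dichotomy may vary with the
  \<open>j\<close>-dimensional subspace, but these subspaces cover \<open>L\<^sub>1\<close> and \<open>L\<^sub>2\<close>, so that each single
  solution obeys an exponential estimate, and limits of single solutions are all that \<open>S \<gamma>\<close>
  asks about (\<open>stable_space_eq_if_dichotomy\<close>). The function \<open>\<gamma> \<mapsto> dim (S \<gamma>)\<close> is therefore well
  defined and monotone, and two facts about it give the shape of the spectrum.

  A dichotomy at \<open>\<gamma>\<close> on a given splitting survives a small change of \<open>\<gamma>\<close>, so the level sets
  of \<open>dim (S \<gamma>)\<close> in the resolvent are open (\<open>resolvent_locally_constant\<close>). If \<open>S\<close> has the same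
  dimension at two resolvent points \<open>\<gamma>\<^sub>1 \<le> \<gamma>\<^sub>2\<close>, the two stable spaces coincide, and pairing the
  decay on \<open>S \<gamma>\<^sub>1\<close> with the growth on the complement that belongs to \<open>\<gamma>\<^sub>2\<close> gives a dichotomy at
  every point in between. The uniformity dimensions fit, since they depend only on the
  dimension of the stable space; hence the level sets are intervals (\<open>resolvent_between\<close>).
  Boundedness of \<open>A\<close> and its inverse puts all large \<open>\<gamma>\<close> in the resolvent with
  \<open>S \<gamma>\<close> the whole space and all very negative ones with \<open>S \<gamma> = {0}\<close>. The resolvent is thus
  the union of at least two and at most \<open>d + 1\<close> disjoint open intervals, two of them unbounded,
  and the spectrum is what lies between consecutive ones
  (\<open>complement_of_ordered_open_intervals\<close>).

  The filtration is \<open>S\<close> evaluated in the successive gaps. For two-sided time the same argument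
  at \<open>-\<infinity>\<close> forces \<open>L\<^sub>2\<close> to be the unstable space \<open>U \<gamma>\<close>. Each gap then gives
  \<open>S \<oplus> U = \<real>\<^sup>d\<close> with \<open>S\<close> increasing and \<open>U\<close> decreasing, and the intersections
  of \<open>S\<close> from one gap with \<open>U\<close> from the preceding gap decompose the space
  (\<open>direct_sum_of_opposite_filtrations\<close>).
\<close>

section \<open>Norms on a Euclidean space\<close>

lemma is_norm_nonneg: "is_norm N \<Longrightarrow> 0 \<le> N x"
  and is_norm_eq_0_iff: "is_norm N \<Longrightarrow> N x = 0 \<longleftrightarrow> x = 0"
  and is_norm_scaleR: "is_norm N \<Longrightarrow> N (c *\<^sub>R x) = \<bar>c\<bar> * N x"
  and is_norm_triangle: "is_norm N \<Longrightarrow> N (x + y) \<le> N x + N y"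
  by (simp_all add: is_norm_def)

lemma is_norm_le_norm:
  fixes N :: "'a::euclidean_space \<Rightarrow> real"
  assumes "is_norm N"
  obtains B where "B > 0" "\<And>x. N x \<le> B * norm x"
proof
  define B where "B = (\<Sum>b\<in>Basis. N b) + 1"
  have nonneg: "0 \<le> (\<Sum>b\<in>Basis. N b)"
    by (intro sum_nonneg is_norm_nonneg assms)
  then show "B > 0"
    by (simp add: B_def)
  fix x :: 'a
  have N_sum: "N (\<Sum>b\<in>F. (x \<bullet> b) *\<^sub>R b) \<le> (\<Sum>b\<in>F. N ((x \<bullet> b) *\<^sub>R b))" if "finite F" for F :: "'a set"
    using that
  proof induction
    case empty
    then show ?case
      using is_norm_eq_0_iff[OF assms, of 0] by simp
  next
    case (insert b F)
    then show ?case
      using is_norm_triangle[OF assms, of "(x \<bullet> b) *\<^sub>R b" "\<Sum>b\<in>F. (x \<bullet> b) *\<^sub>R b"] by simp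
  qed
  have "N x = N (\<Sum>b\<in>Basis. (x \<bullet> b) *\<^sub>R b)"
    by (simp add: euclidean_representation)
  also have "\<dots> \<le> (\<Sum>b\<in>Basis. N ((x \<bullet> b) *\<^sub>R b))"
    by (rule N_sum) simp
  also have "\<dots> \<le> (\<Sum>b\<in>Basis. norm x * N b)"
    by (rule sum_mono) (simp add: is_norm_scaleR[OF assms] mult_right_mono is_norm_nonneg[OF assms] Basis_le_norm)
  also have "\<dots> = (\<Sum>b\<in>Basis. N b) * norm x"
    by (simp add: sum_distrib_left mult.commute)
  also have "\<dots> \<le> B * norm x"
    by (simp add: B_def distrib_right)
  finally show "N x \<le> B * norm x" .
qed

text \<open>
  The upper bound makes \<open>N\<close> continuous, so \<open>N\<close> attains a positive minimum on the compact unit sphere.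
\<close>

lemma norm_le_is_norm:
  fixes N :: "'a::euclidean_space \<Rightarrow> real"
  assumes "is_norm N"
  obtains B where "B > 0" "\<And>x. norm x \<le> B * N x"
proof -
  obtain K where K: "K > 0" "\<And>x. N x \<le> K * norm x"
    using is_norm_le_norm[OF assms] by blast
  have lip: "\<bar>N x - N y\<bar> \<le> K * norm (x - y)" for x y
    using is_norm_triangle[OF assms, of "x - y" y] is_norm_triangle[OF assms, of "y - x" x]
      K(2)[of "x - y"] K(2)[of "y - x"]
    by (simp add: norm_minus_commute abs_le_iff)
  have "continuous_on (sphere 0 1) N"
  proof (rule continuous_onI)
    fix x :: 'a and e :: real
    assume "e > 0"
    then show "\<exists>d>0. \<forall>y\<in>sphere 0 1. dist y x < d \<longrightarrow> dist (N y) (N x) \<le> e"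
      using K(1) lip
      by (intro exI[of _ "e / K"]) (auto simp: dist_norm field_simps intro: order_trans[OF lip])
  qed
  moreover obtain b :: 'a where "b \<in> Basis"
    using nonempty_Basis by blast
  then have "sphere (0::'a) 1 \<noteq> {}"
    by force
  ultimately obtain z where z: "norm z = 1" "\<And>y. norm y = 1 \<Longrightarrow> N z \<le> N y"
    using continuous_attains_inf[of "sphere (0::'a) 1" N] by auto
  then have "N z \<noteq> 0"
    using is_norm_eq_0_iff[OF assms, of z] by auto
  then have pos: "N z > 0"
    using is_norm_nonneg[OF assms, of z] by linarith
  have "norm x \<le> (1 / N z) * N x" for x
  proof (cases "x = 0")
    case True
    then show ?thesis
      by (simp add: is_norm_nonneg[OF assms] less_imp_le[OF pos])
  next
    case False
    then have "N z \<le> N ((1 / norm x) *\<^sub>R x)"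
      by (intro z(2)) simp
    also have "\<dots> = N x / norm x"
      by (simp add: is_norm_scaleR[OF assms])
    finally show ?thesis
      using False pos by (simp add: field_simps)
  qed
  then show ?thesis
    using that[of "1 / N z"] pos by simp
qed

lemma tendsto_0_iff_is_norm:
  fixes N :: "'a::euclidean_space \<Rightarrow> real"
  assumes "is_norm N"
  shows "(f \<longlongrightarrow> 0) F \<longleftrightarrow> ((\<lambda>x. N (f x)) \<longlongrightarrow> 0) F"
proof
  obtain B where B: "B > 0" "\<And>x. N x \<le> B * norm x"
    using is_norm_le_norm[OF assms] by blast
  assume "(f \<longlongrightarrow> 0) F"
  then have "((\<lambda>x. B * norm (f x)) \<longlongrightarrow> 0) F"
    by (intro tendsto_mult_right_zero tendsto_norm_zero)
  then show "((\<lambda>x. N (f x)) \<longlongrightarrow> 0) F"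
    by (rule Lim_null_comparison[rotated])
      (use B(2) is_norm_nonneg[OF assms] in \<open>auto intro!: always_eventually\<close>)
next
  obtain B where B: "B > 0" "\<And>x. norm x \<le> B * N x"
    using norm_le_is_norm[OF assms] by blast
  assume "((\<lambda>x. N (f x)) \<longlongrightarrow> 0) F"
  then have "((\<lambda>x. B * N (f x)) \<longlongrightarrow> 0) F"
    by (rule tendsto_mult_right_zero)
  then show "(f \<longlongrightarrow> 0) F"
    by (rule Lim_null_comparison[rotated]) (use B(2) in \<open>auto intro!: always_eventually\<close>)
qed

lemma bounded_matrices_is_norm_le:
  fixes N :: "real^'n \<Rightarrow> real" and S :: "(real^'n^'n) set"
  assumes "is_norm N" "bounded S"
  shows "\<exists>R. \<forall>M\<in>S. \<forall>x. N (M *v x) \<le> exp R * N x"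
proof -
  obtain B where B: "B > 0" "\<And>x. N x \<le> B * norm x"
    using is_norm_le_norm[OF assms(1)] by blast
  obtain C where C: "C > 0" "\<And>x. norm x \<le> C * N x"
    using norm_le_is_norm[OF assms(1)] by blast
  obtain K where K: "K > 0" "\<And>M. M \<in> S \<Longrightarrow> norm M \<le> K"
    using bounded_pos[of S] assms(2) by auto
  define D where "D = real CARD('n) * real CARD('n) * K"
  have "D > 0"
    using K(1) by (simp add: D_def)
  have bound: "N (M *v x) \<le> B * D * C * N x" if "M \<in> S" for M x
  proof -
    have "\<bar>M $ i $ j\<bar> \<le> K" for i j
    proof -
      have "\<bar>M $ i $ j\<bar> \<le> norm (M $ i)"
        by (rule component_le_norm_cart)
      also have "\<dots> \<le> norm M"
        by (rule Finite_Cartesian_Product.norm_nth_le)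
      also have "\<dots> \<le> K"
        by (rule K(2)[OF that])
      finally show ?thesis .
    qed
    then have "onorm ((*v) M) \<le> D"
      unfolding D_def by (rule onorm_le_matrix_component)
    then have "norm (M *v x) \<le> D * norm x"
      using onorm[OF matrix_vector_mul_bounded_linear, of M x] mult_right_mono[of "onorm ((*v) M)" D "norm x"]
      by fastforce
    also have "\<dots> \<le> D * (C * N x)"
      using \<open>D > 0\<close> C(2) by (intro mult_left_mono) auto
    finally have "B * norm (M *v x) \<le> B * (D * (C * N x))"
      using B(1) by (intro mult_left_mono) auto
    then show ?thesis
      using B(2)[of "M *v x"] by (simp add: mult.assoc)
  qed
  have "B * D * C > 0"
    using B(1) C(1) \<open>D > 0\<close> by simp
  then show ?thesis
    using bound by (intro exI[of _ "ln (B * D * C)"]) simp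
qed

section \<open>Splittings, filtrations and direct sums\<close>

lemma splittingE:
  assumes "splitting L1 L2"
  obtains u v where "u \<in> L1" "v \<in> L2" "x = u + v"
  using assms unfolding splitting_def by blast

lemma splitting_commute:
  assumes "splitting L1 L2"
  shows "splitting L2 L1"
proof -
  have "\<exists>u v. x = u + v \<and> u \<in> L2 \<and> v \<in> L1" for x
  proof -
    obtain u v where "u \<in> L1" "v \<in> L2" "x = u + v"
      using splittingE[OF assms] .
    then have "x = v + u \<and> v \<in> L2 \<and> u \<in> L1"
      by (simp add: add.commute)
    then show ?thesis
      by blast
  qed
  then have "{u + v |u v. u \<in> L2 \<and> v \<in> L1} = UNIV"
    by blast
  then show ?thesis
    using assms by (simp add: splitting_def Int_commute)
qed

lemma splitting_UNIV_0: "splitting UNIV {0::'a::euclidean_space}"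
  by (auto simp: splitting_def subspace_0)

text \<open>
  A summand cannot be enlarged without meeting its complement; this modular law is what
  identifies the spaces of a dichotomy with the spaces of decaying solutions.
\<close>

lemma splitting_summand_maximal:
  assumes "splitting L1 L2" "subspace S" "L1 \<subseteq> S" "S \<inter> L2 \<subseteq> {0}"
  shows "L1 = S"
proof
  show "S \<subseteq> L1"
  proof
    fix x
    assume "x \<in> S"
    obtain u v where uv: "u \<in> L1" "v \<in> L2" "x = u + v"
      using splittingE[OF assms(1)] .
    have "x - u \<in> S"
      using \<open>x \<in> S\<close> uv(1) assms(2,3) by (blast intro: subspace_diff)
    then have "v \<in> S \<inter> L2"
      using uv by simp
    then show "x \<in> L1"
      using uv assms(4) by auto
  qed
qed fact

lemma subspace_cover_by_dim:
  assumes "1 \<le> j" "j \<le> DIM('a::euclidean_space)"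
  shows "\<Union>(subspaces_of_dim j (UNIV :: 'a::euclidean_space set)) = UNIV"
proof -
  have "\<exists>U. subspace U \<and> dim U = j \<and> x \<in> U" for x :: 'a
  proof (cases "x = 0")
    case True
    obtain U :: "'a set" where "subspace U" "dim U = j"
      using choose_subspace_of_subspace[of j "UNIV :: 'a set"] assms(2) by auto
    then show ?thesis
      using True subspace_0 by blast
  next
    case False
    \<comment> \<open>Join the line spanned by \<open>x\<close> with \<open>j - 1\<close> dimensions orthogonal to it.\<close>
    have "j - 1 \<le> dim {y. x \<bullet> y = 0}"
      using dim_hyperplane[OF False] assms(2) by simp
    then obtain V where V: "subspace V" "V \<subseteq> span {y. x \<bullet> y = 0}" "dim V = j - 1"
      by (rule choose_subspace_of_subspace)
    have "span {y. x \<bullet> y = 0} = {y. x \<bullet> y = 0}"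
      by (rule span_eq_iff[THEN iffD2, OF subspace_hyperplane])
    then have "V \<subseteq> {y. x \<bullet> y = 0}"
      by (rule subset_trans[OF V(2) equalityD1])
    then have "x \<notin> V"
      using False by auto
    then have "x \<notin> span V"
      by (simp add: span_eq_iff[THEN iffD2, OF V(1)])
    then have "dim (span (insert x V)) = j"
      using V(3) assms(1) by (simp add: dim_insert)
    moreover have "x \<in> span (insert x V)"
      by (simp add: span_base)
    ultimately show ?thesis
      using subspace_span by blast
  qed
  then show ?thesis
    by (auto simp: subspaces_of_dim_def)
qed

lemma subspaces_of_dim_0: "subspaces_of_dim 0 {0::'a::euclidean_space} = {{0}}"
  by (auto simp: subspaces_of_dim_def subspace_0)

text \<open>
  Peeling off one summand at a time: \<open>S m\<close> is the direct sum of \<open>S (m - 1)\<close> and \<open>W m\<close>,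
  because an element of \<open>S m\<close> splits along \<open>S (m - 1)\<close> and \<open>U (m - 1)\<close>, and its second component
  stays in \<open>S m\<close>.
\<close>

lemma direct_sum_of_opposite_filtrations:
  fixes S U :: "nat \<Rightarrow> ('a::euclidean_space) set"
  assumes split: "\<And>k. k \<le> l \<Longrightarrow> splitting (S k) (U k)"
    and S_0: "S 0 = {0}" and S_l: "S l = UNIV"
    and S_mono: "\<And>k. k < l \<Longrightarrow> S k \<subseteq> S (Suc k)"
  shows "direct_sum_decomposition {1..l} (\<lambda>k. U (k - 1) \<inter> S k)"
proof -
  define W where "W = (\<lambda>k. U (k - 1) \<inter> S k)"
  have sub: "subspace (S k)" "subspace (U k)" "S k \<inter> U k = {0}" if "k \<le> l" for k
    using split[OF that] by (auto simp: splitting_def)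
  have sub_W: "subspace (W k)" if "k \<in> {1..l}" for k
    using sub that by (auto simp: W_def intro!: subspace_inter)
  have S_le: "S i \<subseteq> S k" if "i \<le> k" "k \<le> l" for i k
    using that(1,2)
  proof (induction rule: dec_induct)
    case (step k)
    then show ?case
      using S_mono[of k] by auto
  qed simp
  have sum_in: "(\<Sum>i\<in>{1..m}. w i) \<in> S m" if "m \<le> l" "\<And>i. i \<in> {1..m} \<Longrightarrow> w i \<in> W i" for m w
  proof (rule subspace_sum[OF sub(1)[OF that(1)]])
    fix i
    assume "i \<in> {1..m}"
    then show "w i \<in> S m"
      using that(2)[of i] S_le[of i m] that(1) by (auto simp: W_def)
  qed
  have exist: "\<exists>w. (\<forall>i\<in>{1..m}. w i \<in> W i) \<and> x = (\<Sum>i\<in>{1..m}. w i)" if "m \<le> l" "x \<in> S m" for m x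
    using that
  proof (induction m arbitrary: x)
    case 0
    then show ?case
      using S_0 by simp
  next
    case (Suc m)
    obtain s u where su: "s \<in> S m" "u \<in> U m" "x = s + u"
      using splittingE[OF split[OF Suc_leD[OF Suc.prems(1)]]] .
    have "s \<in> S (Suc m)"
      using su(1) S_mono[of m] Suc.prems(1) by auto
    then have "x - s \<in> S (Suc m)"
      using sub(1)[OF Suc.prems(1)] Suc.prems(2) by (blast intro: subspace_diff)
    then have u: "u \<in> W (Suc m)"
      using su by (simp add: W_def)
    obtain w where w: "\<forall>i\<in>{1..m}. w i \<in> W i" "s = (\<Sum>i\<in>{1..m}. w i)"
      using Suc.IH[of s] Suc.prems(1) su(1) by auto
    have "(\<Sum>i\<in>{1..m}. (w(Suc m := u)) i) = (\<Sum>i\<in>{1..m}. w i)"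
      by (rule sum.cong) auto
    then have "x = (\<Sum>i\<in>{1..Suc m}. (w(Suc m := u)) i)"
      using su(3) w(2) by simp
    moreover have "\<forall>i\<in>{1..Suc m}. (w(Suc m := u)) i \<in> W i"
      using w(1) u by auto
    ultimately show ?case
      by blast
  qed
  have zero: "\<forall>i\<in>{1..m}. w i = 0"
    if "m \<le> l" "\<And>i. i \<in> {1..m} \<Longrightarrow> w i \<in> W i" "(\<Sum>i\<in>{1..m}. w i) = 0" for m w
    using that
  proof (induction m)
    case (Suc m)
    have "w (Suc m) = - (\<Sum>i\<in>{1..m}. w i)"
      using Suc.prems(3) by (simp add: eq_neg_iff_add_eq_0 add.commute)
    moreover have "(\<Sum>i\<in>{1..m}. w i) \<in> S m"
      using Suc.prems by (intro sum_in) auto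
    ultimately have "w (Suc m) \<in> S m"
      using sub(1)[of m] Suc.prems(1) by (simp add: subspace_neg)
    moreover have "w (Suc m) \<in> U m"
      using Suc.prems(2)[of "Suc m"] by (auto simp: W_def)
    ultimately have "w (Suc m) = 0"
      using sub(3)[of m] Suc.prems(1) by auto
    then show ?case
      using Suc by (auto simp: le_Suc_eq)
  qed simp
  have "\<exists>!w. w \<in> (\<Pi>\<^sub>E i\<in>{1..l}. W i) \<and> x = (\<Sum>i\<in>{1..l}. w i)" for x
  proof -
    obtain w where w: "\<forall>i\<in>{1..l}. w i \<in> W i" "x = (\<Sum>i\<in>{1..l}. w i)"
      using exist[of l x] S_l by auto
    show ?thesis
    proof (rule ex1I[of _ "restrict w {1..l}"])
      show "restrict w {1..l} \<in> (\<Pi>\<^sub>E i\<in>{1..l}. W i) \<and> x = (\<Sum>i\<in>{1..l}. restrict w {1..l} i)"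
        using w by auto
    next
      fix v
      assume v: "v \<in> (\<Pi>\<^sub>E i\<in>{1..l}. W i) \<and> x = (\<Sum>i\<in>{1..l}. v i)"
      have "\<forall>i\<in>{1..l}. v i - w i = 0"
      proof (rule zero)
        show "v i - w i \<in> W i" if "i \<in> {1..l}" for i
          using v w(1) sub_W that by (intro subspace_diff) auto
        show "(\<Sum>i\<in>{1..l}. v i - w i) = 0"
          using v w(2) by (simp add: sum_subtractf)
      qed simp
      then show "v = restrict w {1..l}"
        using v by (intro PiE_ext[of v "{1..l}" W]) (use w in auto)
    qed
  qed
  then show ?thesis
    using sub_W by (simp add: direct_sum_decomposition_def W_def)
qed

section \<open>Complements of ordered families of open intervals\<close>

lemma mem_open_interval_iff:
  fixes P :: "real set"
  assumes "open P" "is_interval P"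
  shows "t \<in> P \<longleftrightarrow> (\<exists>s\<in>P. s < t) \<and> (\<exists>s\<in>P. t < s)"
proof
  assume "t \<in> P"
  then obtain e where "e > 0" and e: "\<And>s. dist s t < e \<Longrightarrow> s \<in> P"
    using assms(1) open_dist by metis
  then have "t - e / 2 \<in> P" "t + e / 2 \<in> P"
    by (auto simp: dist_real_def)
  with \<open>e > 0\<close> show "(\<exists>s\<in>P. s < t) \<and> (\<exists>s\<in>P. t < s)"
    by (intro conjI bexI[of _ "t - e / 2"] bexI[of _ "t + e / 2"]) auto
next
  assume "(\<exists>s\<in>P. s < t) \<and> (\<exists>s\<in>P. t < s)"
  then show "t \<in> P"
    using assms(2) unfolding is_interval_1 by (metis less_imp_le)
qed

text \<open>
  The intervals of the complement run from the supremum of one \<open>P i\<close> to the infimum of the next.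
  Each \<open>P i\<close> is then one of the gaps: an open interval is described by its infimum and supremum,
  and by infinite ends where it is unbounded, which happens at the first and the last index only.
\<close>

lemma complement_of_ordered_open_intervals:
  fixes P :: "nat \<Rightarrow> real set"
  assumes open_P: "\<And>i. i \<le> l \<Longrightarrow> open (P i)"
    and interval_P: "\<And>i. i \<le> l \<Longrightarrow> is_interval (P i)"
    and nonempty_P: "\<And>i. i \<le> l \<Longrightarrow> P i \<noteq> {}"
    and ordered: "\<And>i j s t. i < j \<Longrightarrow> j \<le> l \<Longrightarrow> s \<in> P i \<Longrightarrow> t \<in> P j \<Longrightarrow> s < t"
    and unbounded_below: "\<And>t. \<exists>s\<in>P 0. s < t"
    and unbounded_above: "\<And>t. \<exists>s\<in>P l. t < s"
  obtains a b :: "nat \<Rightarrow> real" where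
    "\<forall>k\<in>{1..l}. a k \<le> b k" "\<forall>k\<in>{1..<l}. b k < a (k + 1)"
    "- (\<Union>i\<le>l. P i) = (\<Union>k\<in>{1..l}. {a k..b k})"
    "\<forall>k\<le>l. gap l a b k = P k"
proof
  define a where "a k = Sup (P (k - 1))" for k
  define b where "b k = Inf (P k)" for k
  have mem_P: "t \<in> P i \<longleftrightarrow> (\<exists>s\<in>P i. s < t) \<and> (\<exists>s\<in>P i. t < s)" if "i \<le> l" for i t
    by (rule mem_open_interval_iff[OF open_P[OF that] interval_P[OF that]])
  have above: "(\<exists>s\<in>P i. t < s) \<longleftrightarrow> t < a (Suc i)" if il: "i < l" for i t
  proof -
    obtain u where "u \<in> P (Suc i)"
      using nonempty_P[of "Suc i"] il by auto
    then have "bdd_above (P i)"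
      using ordered[of i "Suc i"] il by (intro bdd_aboveI[of _ u]) (auto intro: less_imp_le)
    then show ?thesis
      using less_cSup_iff[of "P i" t] nonempty_P[of i] il by (auto simp: a_def)
  qed
  have below: "(\<exists>s\<in>P i. s < t) \<longleftrightarrow> b i < t" if il: "1 \<le> i" "i \<le> l" for i t
  proof -
    have "i - 1 \<le> l"
      using il by linarith
    then obtain u where "u \<in> P (i - 1)"
      using nonempty_P by blast
    then have "bdd_below (P i)"
      using ordered[of "i - 1" i] il by (intro bdd_belowI[of _ u]) (auto intro: less_imp_le)
    then show ?thesis
      using cInf_less_iff[of "P i" t] nonempty_P[of i] il by (auto simp: b_def)
  qed
  show gap: "\<forall>k\<le>l. gap l a b k = P k"
  proof (intro allI impI set_eqI)
    fix k t
    assume "k \<le> l"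
    have "(if k = 0 then - \<infinity> else ereal (b k)) < ereal t \<longleftrightarrow> (\<exists>s\<in>P k. s < t)"
    proof (cases "k = 0")
      case True
      then show ?thesis
        using unbounded_below[of t] by simp
    next
      case False
      then have "1 \<le> k"
        by simp
      show ?thesis
        unfolding below[OF \<open>1 \<le> k\<close> \<open>k \<le> l\<close>] using False by simp
    qed
    moreover have "ereal t < (if k = l then \<infinity> else ereal (a (k + 1))) \<longleftrightarrow> (\<exists>s\<in>P k. t < s)"
    proof (cases "k = l")
      case True
      then show ?thesis
        using unbounded_above[of t] by simp
    next
      case False
      then have "k < l"
        using \<open>k \<le> l\<close> by simp
      show ?thesis
        unfolding above[OF \<open>k < l\<close>] using False by simp
    qed
    ultimately show "t \<in> gap l a b k \<longleftrightarrow> t \<in> P k"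
      unfolding gap_def mem_Collect_eq mem_P[OF \<open>k \<le> l\<close>]
      by simp
  qed
  show "\<forall>k\<in>{1..l}. a k \<le> b k"
  proof
    fix k
    assume k: "k \<in> {1..l}"
    then have "k - 1 < l"
      by (simp, linarith)
    show "a k \<le> b k"
    proof (rule ccontr)
      assume "\<not> a k \<le> b k"
      then obtain s where "s \<in> P k" "s < a k"
        using below[of k "a k"] k by auto
      then obtain s' where "s' \<in> P (k - 1)" "s < s'"
        using above[OF \<open>k - 1 < l\<close>, of s] k by auto
      then show False
        using ordered[of "k - 1" k s' s] \<open>s \<in> P k\<close> k by auto
    qed
  qed
  show "\<forall>k\<in>{1..<l}. b k < a (k + 1)"
  proof
    fix k
    assume k: "k \<in> {1..<l}"
    then obtain t where "t \<in> P k"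
      using nonempty_P[of k] by auto
    then have "b k < t" "t < a (k + 1)"
      using mem_P[of k t] above[of k t] below[of k t] k by auto
    then show "b k < a (k + 1)"
      by simp
  qed
  show "- (\<Union>i\<le>l. P i) = (\<Union>k\<in>{1..l}. {a k..b k})"
  proof (intro equalityI subsetI)
    fix t
    assume t: "t \<in> - (\<Union>i\<le>l. P i)"
    \<comment> \<open>The last interval that begins to the left of \<open>t\<close> also ends there, as it does not contain \<open>t\<close>.\<close>
    define I where "I = {i. i \<le> l \<and> (\<exists>s\<in>P i. s < t)}"
    define i where "i = Max I"
    have "finite I" "0 \<in> I"
      using unbounded_below by (auto simp: I_def)
    then have "i \<in> I"
      unfolding i_def by (intro Max_in) auto
    then have i: "i \<le> l" "\<exists>s\<in>P i. s < t"
      by (auto simp: I_def)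
    then have none: "\<not> (\<exists>s\<in>P i. t < s)"
      using t mem_P[of i t] by auto
    then have "i < l"
      using i(1) unbounded_above[of t] by (cases "i = l") auto
    have "Suc i \<notin> I"
      using Max_ge[OF \<open>finite I\<close>, of "Suc i"] by (auto simp: i_def)
    then have "t \<le> b (Suc i)"
      using below[of "Suc i" t] \<open>i < l\<close> by (auto simp: I_def not_less)
    moreover have "a (Suc i) \<le> t"
      using above[OF \<open>i < l\<close>, of t] none by auto
    ultimately show "t \<in> (\<Union>k\<in>{1..l}. {a k..b k})"
      using \<open>i < l\<close> by (intro UN_I[of "Suc i"]) auto
  next
    fix t
    assume "t \<in> (\<Union>k\<in>{1..l}. {a k..b k})"
    then obtain k where k: "1 \<le> k" "k \<le> l" "a k \<le> t" "t \<le> b k"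
      by auto
    then have "k - 1 < l"
      by linarith
    have left: "s \<le> t" if "s \<in> P (k - 1)" for s
      using above[OF \<open>k - 1 < l\<close>, of t] that k by (force simp: not_less)
    have right: "t \<le> s" if "s \<in> P k" for s
      using below[OF k(1,2), of t] that k by (force simp: not_less)
    have "t \<notin> P i" if "i \<le> l" for i
    proof
      assume "t \<in> P i"
      consider "i < k - 1" | "i = k - 1" | "i = k" | "k < i"
        by linarith
      then show False
      proof cases
        case 1
        obtain s where "s \<in> P (k - 1)"
          using nonempty_P[of "k - 1"] \<open>k - 1 < l\<close> by fastforce
        then show False
          using ordered[OF 1 less_imp_le[OF \<open>k - 1 < l\<close>], of t s] left[of s] \<open>t \<in> P i\<close> by auto
      next
        case 2
        then show False
          using mem_P[of i t] left \<open>t \<in> P i\<close> that by force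
      next
        case 3
        then show False
          using mem_P[of i t] right \<open>t \<in> P i\<close> that by force
      next
        case 4
        obtain s where "s \<in> P k"
          using nonempty_P[of k] k by auto
        then show False
          using ordered[OF 4 that, of s t] right[of s] \<open>t \<in> P i\<close> by auto
      qed
    qed
    then show "t \<in> - (\<Union>i\<le>l. P i)"
      by auto
  qed
qed

text \<open>
  The values of \<open>f\<close> on \<open>R\<close>, listed in increasing order by \<open>\<kappa>\<close>, lie in \<open>{0..d}\<close> and include both
  ends, which bounds their number by \<open>d + 1\<close> from above and by \<open>2\<close> from below. Monotonicity of \<open>f\<close>
  orders the level sets along the line.
\<close>

lemma complement_of_monotone_levels:
  fixes R :: "real set" and f :: "real \<Rightarrow> nat"
  assumes "1 \<le> d"
    and f_le: "\<And>t. f t \<le> d"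
    and f_mono: "\<And>s t. s \<le> t \<Longrightarrow> f s \<le> f t"
    and loc_const: "\<And>t. t \<in> R \<Longrightarrow> \<exists>e>0. \<forall>s. \<bar>s - t\<bar> < e \<longrightarrow> s \<in> R \<and> f s = f t"
    and between: "\<And>r s t. r \<in> R \<Longrightarrow> t \<in> R \<Longrightarrow> f r = f t \<Longrightarrow> r \<le> s \<Longrightarrow> s \<le> t \<Longrightarrow> s \<in> R"
    and at_left: "\<And>t. t < - c \<Longrightarrow> t \<in> R \<and> f t = 0"
    and at_right: "\<And>t. t > c \<Longrightarrow> t \<in> R \<and> f t = d"
  obtains l :: nat and a b :: "nat \<Rightarrow> real" and \<kappa> :: "nat \<Rightarrow> nat" where
    "l \<in> {1..d}"
    "\<forall>k\<in>{1..l}. a k \<le> b k" "\<forall>k\<in>{1..<l}. b k < a (k + 1)"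
    "- R = (\<Union>k\<in>{1..l}. {a k..b k})"
    "\<forall>k\<le>l. gap l a b k = {t \<in> R. f t = \<kappa> k}" "\<forall>k\<le>l. gap l a b k \<noteq> {}"
    "strict_mono_on {..l} \<kappa>" "\<kappa> 0 = 0" "\<kappa> l = d"
proof -
  define V where "V = f ` R"
  have "V \<subseteq> {..d}"
    using f_le by (auto simp: V_def)
  then have "finite V"
    using finite_subset by blast
  have "0 \<in> V" "d \<in> V"
    using at_left[of "- c - 1"] at_right[of "c + 1"] by (force simp: V_def)+
  obtain \<kappa> where \<kappa>: "bij_betw \<kappa> {..<card V} V" "strict_mono_on {..<card V} \<kappa>"
    using ex_bij_betw_strict_mono_card[OF \<open>finite V\<close>] .
  define l where "l = card V - 1"
  have "card {0, d} \<le> card V"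
    using \<open>0 \<in> V\<close> \<open>d \<in> V\<close> \<open>finite V\<close> by (intro card_mono) auto
  then have "2 \<le> card V"
    using \<open>1 \<le> d\<close> by simp
  moreover have "card V \<le> Suc d"
    using card_mono[OF _ \<open>V \<subseteq> {..d}\<close>] by simp
  ultimately have l: "l \<in> {1..d}" and "{..<card V} = {..l}"
    by (auto simp: l_def)
  then have \<kappa>_bij: "bij_betw \<kappa> {..l} V" and \<kappa>_mono: "strict_mono_on {..l} \<kappa>"
    using \<kappa> by auto
  have \<kappa>_less: "\<kappa> i < \<kappa> j" if "i < j" "j \<le> l" for i j
    using strict_mono_onD[OF \<kappa>_mono, of i j] that by simp
  have \<kappa>_le: "\<kappa> i \<le> \<kappa> j" if "i \<le> j" "j \<le> l" for i j
    using \<kappa>_less[of i j] that by (cases "i = j") auto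
  obtain i0 i1 where "i0 \<le> l" "\<kappa> i0 = 0" "i1 \<le> l" "\<kappa> i1 = d"
    using \<kappa>_bij \<open>0 \<in> V\<close> \<open>d \<in> V\<close> unfolding bij_betw_def by (metis atMost_iff imageE)
  moreover have "\<kappa> l \<le> d"
    using \<kappa>_bij \<open>V \<subseteq> {..d}\<close> unfolding bij_betw_def by auto
  ultimately have \<kappa>_0: "\<kappa> 0 = 0" and \<kappa>_l: "\<kappa> l = d"
    using \<kappa>_le[of 0 i0] \<kappa>_le[of i1 l] by auto
  define P where "P i = {t \<in> R. f t = \<kappa> i}" for i
  have union: "(\<Union>i\<le>l. P i) = R"
  proof (intro equalityI subsetI)
    fix t
    assume "t \<in> R"
    then have "f t \<in> \<kappa> ` {..l}"
      using \<kappa>_bij by (auto simp: bij_betw_def V_def)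
    then show "t \<in> (\<Union>i\<le>l. P i)"
      using \<open>t \<in> R\<close> by (auto simp: P_def)
  qed (auto simp: P_def)
  have nonempty: "P i \<noteq> {}" if "i \<le> l" for i
  proof -
    have "\<kappa> i \<in> f ` R"
      using \<kappa>_bij that by (auto simp: bij_betw_def V_def)
    then show ?thesis
      by (auto simp: P_def)
  qed
  obtain a b where ab:
    "\<forall>k\<in>{1..l}. a k \<le> b k" "\<forall>k\<in>{1..<l}. b k < a (k + 1)"
    "- (\<Union>i\<le>l. P i) = (\<Union>k\<in>{1..l}. {a k..b k})" "\<forall>k\<le>l. gap l a b k = P k"
  proof (rule complement_of_ordered_open_intervals[of l P])
    show "open (P i)" for i
      unfolding open_dist
    proof
      fix t
      assume "t \<in> P i"
      then show "\<exists>e>0. \<forall>s. dist s t < e \<longrightarrow> s \<in> P i"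
        using loc_const[of t] by (auto simp: P_def dist_real_def)
    qed
    show "is_interval (P i)" for i
      unfolding is_interval_1
    proof (intro ballI allI impI)
      fix r t s
      assume "r \<in> P i" "t \<in> P i" and rst: "r \<le> s \<and> s \<le> t"
      then have "s \<in> R"
        using between[of r t s] by (auto simp: P_def)
      moreover have "f s = \<kappa> i"
        using f_mono[of r s] f_mono[of s t] rst \<open>r \<in> P i\<close> \<open>t \<in> P i\<close> by (auto simp: P_def)
      ultimately show "s \<in> P i"
        by (simp add: P_def)
    qed
    show "s < t" if "i < j" "j \<le> l" "s \<in> P i" "t \<in> P j" for i j s t
      using \<kappa>_less[OF that(1,2)] f_mono[of t s] that(3,4) by (force simp: P_def)
    show "\<exists>s\<in>P 0. s < t" for t
      using at_left[of "min t (- c) - 1"] \<kappa>_0 by (intro bexI[of _ "min t (- c) - 1"]) (auto simp: P_def)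
    show "\<exists>s\<in>P l. t < s" for t
      using at_right[of "max t c + 1"] \<kappa>_l by (intro bexI[of _ "max t c + 1"]) (auto simp: P_def)
  qed (use nonempty in blast)+
  have "- R = (\<Union>k\<in>{1..l}. {a k..b k})"
    using ab(3) unfolding union .
  moreover have "\<forall>k\<le>l. gap l a b k \<noteq> {}"
    using ab(4) nonempty by simp
  ultimately show ?thesis
    using that[OF l ab(1,2) _ _ _ \<kappa>_mono \<kappa>_0 \<kappa>_l] ab(4) unfolding P_def by blast
qed

section \<open>Spaces of decaying solutions\<close>

definition stable_space :: "(int \<Rightarrow> real^'n^'n) \<Rightarrow> real \<Rightarrow> (real^'n) set" where
  "stable_space A \<gamma> = {x0. ((\<lambda>n::int. exp (- \<gamma> * real_of_int n) *\<^sub>R sol A n x0) \<longlongrightarrow> 0) at_top}"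

definition unstable_space :: "(int \<Rightarrow> real^'n^'n) \<Rightarrow> real \<Rightarrow> (real^'n) set" where
  "unstable_space A \<gamma> = {x0. ((\<lambda>n::int. exp (- \<gamma> * real_of_int n) *\<^sub>R sol A n x0) \<longlongrightarrow> 0) at_bot}"

lemma sol_zero: "sol A n 0 = 0"
  and sol_add: "sol A n (x + y) = sol A n x + sol A n y"
  and sol_scaleR: "sol A n (c *\<^sub>R x) = c *\<^sub>R sol A n x"
  by (simp_all add: sol_def matrix_vector_right_distrib matrix_vector_mult_scaleR)

lemma subspace_weighted_null_solutions:
  "subspace {x0. ((\<lambda>n. w n *\<^sub>R sol A n x0) \<longlongrightarrow> 0) F}"
proof -
  have "((\<lambda>n. w n *\<^sub>R sol A n (x + y)) \<longlongrightarrow> 0) F"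
    if "((\<lambda>n. w n *\<^sub>R sol A n x) \<longlongrightarrow> 0) F" "((\<lambda>n. w n *\<^sub>R sol A n y) \<longlongrightarrow> 0) F" for x y
    using tendsto_add[OF that] by (simp add: sol_add scaleR_add_right)
  moreover have "((\<lambda>n. w n *\<^sub>R sol A n (c *\<^sub>R x)) \<longlongrightarrow> 0) F"
    if "((\<lambda>n. w n *\<^sub>R sol A n x) \<longlongrightarrow> 0) F" for c x
    using tendsto_scaleR[OF tendsto_const[of c] that] by (simp add: sol_scaleR mult.commute)
  ultimately show ?thesis
    by (auto simp: subspace_def sol_zero)
qed

lemma subspace_stable_space: "subspace (stable_space A \<gamma>)"
  and subspace_unstable_space: "subspace (unstable_space A \<gamma>)"
  unfolding stable_space_def unstable_space_def by (rule subspace_weighted_null_solutions)+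

lemma stable_space_mono:
  assumes "\<gamma> \<le> \<gamma>'"
  shows "stable_space A \<gamma> \<subseteq> stable_space A \<gamma>'"
proof
  fix x
  assume "x \<in> stable_space A \<gamma>"
  then have lim: "((\<lambda>n. norm (exp (- \<gamma> * real_of_int n) *\<^sub>R sol A n x)) \<longlongrightarrow> 0) at_top"
    unfolding stable_space_def by (simp only: mem_Collect_eq tendsto_norm_zero)
  have "\<forall>\<^sub>F n in at_top. norm (exp (- \<gamma>' * real_of_int n) *\<^sub>R sol A n x)
      \<le> norm (exp (- \<gamma> * real_of_int n) *\<^sub>R sol A n x)"
    using eventually_ge_at_top[of 0]
    by eventually_elim (use assms in \<open>auto intro!: mult_right_mono\<close>)
  then show "x \<in> stable_space A \<gamma>'"
    unfolding stable_space_def mem_Collect_eq by (rule Lim_null_comparison[OF _ lim])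
qed

lemma unstable_space_antimono:
  assumes "\<gamma> \<le> \<gamma>'"
  shows "unstable_space A \<gamma>' \<subseteq> unstable_space A \<gamma>"
proof
  fix x
  assume "x \<in> unstable_space A \<gamma>'"
  then have lim: "((\<lambda>n. norm (exp (- \<gamma>' * real_of_int n) *\<^sub>R sol A n x)) \<longlongrightarrow> 0) at_bot"
    unfolding unstable_space_def by (simp only: mem_Collect_eq tendsto_norm_zero)
  have "\<forall>\<^sub>F n in at_bot. norm (exp (- \<gamma> * real_of_int n) *\<^sub>R sol A n x)
      \<le> norm (exp (- \<gamma>' * real_of_int n) *\<^sub>R sol A n x)"
    using eventually_le_at_bot[of 0]
  proof eventually_elim
    case (elim n)
    then have "\<gamma>' * real_of_int n \<le> \<gamma> * real_of_int n"
      using assms by (intro mult_right_mono_neg) auto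
    then show ?case
      by (auto intro!: mult_right_mono)
  qed
  then show "x \<in> unstable_space A \<gamma>"
    unfolding unstable_space_def mem_Collect_eq by (rule Lim_null_comparison[OF _ lim])
qed

lemma tendsto_exp_minus_of_int: "((\<lambda>n::int. exp (- (\<alpha> * real_of_int n))) \<longlongrightarrow> 0) at_top" if "\<alpha> > 0"
proof -
  have "filterlim (\<lambda>n::int. \<alpha> * real_of_int n) at_top at_top"
    using that by (intro filterlim_tendsto_pos_mult_at_top[OF tendsto_const] filterlim_real_of_int_at_top)
  then show ?thesis
    by (intro filterlim_compose[OF exp_at_bot] filterlim_uminus_at_bot_at_top[THEN filterlim_compose])
qed

lemma tendsto_exp_of_int: "((\<lambda>n::int. exp (\<alpha> * real_of_int n)) \<longlongrightarrow> 0) at_bot" if "\<alpha> > 0"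
proof -
  have "filterlim real_of_int at_bot at_bot"
    unfolding filterlim_at_bot
  proof
    fix c :: real
    show "\<forall>\<^sub>F n in at_bot. real_of_int n \<le> c"
      using eventually_le_at_bot[of "\<lfloor>c\<rfloor>"] by eventually_elim (simp add: le_floor_iff)
  qed
  then have "filterlim (\<lambda>n::int. \<alpha> * real_of_int n) at_bot at_bot"
    using that by (intro filterlim_tendsto_pos_mult_at_bot[OF tendsto_const])
  then show ?thesis
    by (rule filterlim_compose[OF exp_at_bot])
qed

section \<open>The two halves of a dichotomy\<close>

text \<open>
  Splitting the dichotomy estimates into decay at rate \<open>\<gamma> - \<alpha>\<close> on \<open>L\<^sub>1\<close> and growth at rate
  \<open>\<gamma> + \<alpha>\<close> on \<open>L\<^sub>2\<close> makes it possible to recombine halves that come from different \<open>\<gamma>\<close>.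
\<close>

definition decays_on where
  "decays_on T N A j L \<beta> \<longleftrightarrow> \<Union>(subspaces_of_dim j L) = L \<and>
     (\<forall>U \<in> subspaces_of_dim j L. \<exists>C>0. \<forall>m\<in>T. \<forall>n\<in>T. \<forall>x0\<in>U. m \<le> n \<longrightarrow>
        N (sol A n x0) \<le> C * exp (\<beta> * real_of_int (n - m)) * N (sol A m x0))"

definition grows_on where
  "grows_on T N A j L \<beta> \<longleftrightarrow> \<Union>(subspaces_of_dim j L) = L \<and>
     (\<forall>U \<in> subspaces_of_dim j L. \<exists>C>0. \<forall>m\<in>T. \<forall>n\<in>T. \<forall>x0\<in>U. m \<le> n \<longrightarrow>
        N (sol A n x0) \<ge> C * exp (\<beta> * real_of_int (n - m)) * N (sol A m x0))"

lemma has_dichotomy_iff: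
  "has_dichotomy T N A \<gamma> L1 L2 j \<longleftrightarrow>
     (\<exists>\<alpha>>0. decays_on T N A (fst j) L1 (\<gamma> - \<alpha>) \<and> grows_on T N A (snd j) L2 (\<gamma> + \<alpha>))"
  unfolding has_dichotomy_def decays_on_def grows_on_def by auto

lemma decays_onE:
  assumes "decays_on T N A j L \<beta>" "x0 \<in> L"
  obtains C where "C > 0"
    "\<And>m n. m \<in> T \<Longrightarrow> n \<in> T \<Longrightarrow> m \<le> n \<Longrightarrow>
       N (sol A n x0) \<le> C * exp (\<beta> * real_of_int (n - m)) * N (sol A m x0)"
proof -
  obtain U where "U \<in> subspaces_of_dim j L" "x0 \<in> U"
    using assms unfolding decays_on_def by blast
  then show ?thesis
    using assms(1) that unfolding decays_on_def by meson
qed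

lemma grows_onE:
  assumes "grows_on T N A j L \<beta>" "x0 \<in> L"
  obtains C where "C > 0"
    "\<And>m n. m \<in> T \<Longrightarrow> n \<in> T \<Longrightarrow> m \<le> n \<Longrightarrow>
       C * exp (\<beta> * real_of_int (n - m)) * N (sol A m x0) \<le> N (sol A n x0)"
proof -
  obtain U where "U \<in> subspaces_of_dim j L" "x0 \<in> U"
    using assms unfolding grows_on_def by blast
  then show ?thesis
    using assms(1) that unfolding grows_on_def by meson
qed

lemma decays_on_mono:
  assumes "is_norm N" "decays_on T N A j L \<beta>" "\<beta> \<le> \<beta>'"
  shows "decays_on T N A j L \<beta>'"
proof -
  have "C * exp (\<beta> * real_of_int (n - m)) * N (sol A m x0) \<le> C * exp (\<beta>' * real_of_int (n - m)) * N (sol A m x0)"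
    if "C > 0" "m \<le> n" for C m n x0
    using that assms(3) is_norm_nonneg[OF assms(1)]
    by (intro mult_right_mono mult_left_mono) (auto intro!: mult_right_mono)
  then show ?thesis
    using assms(2) unfolding decays_on_def by (meson order_trans)
qed

lemma grows_on_antimono:
  assumes "is_norm N" "grows_on T N A j L \<beta>" "\<beta>' \<le> \<beta>"
  shows "grows_on T N A j L \<beta>'"
proof -
  have "C * exp (\<beta>' * real_of_int (n - m)) * N (sol A m x0) \<le> C * exp (\<beta> * real_of_int (n - m)) * N (sol A m x0)"
    if "C > 0" "m \<le> n" for C m n x0
    using that assms(3) is_norm_nonneg[OF assms(1)]
    by (intro mult_right_mono mult_left_mono) (auto intro!: mult_right_mono)
  then show ?thesis
    using assms(2) unfolding grows_on_def by (meson order_trans)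
qed

lemma has_dichotomy_perturb:
  assumes "is_norm N" "has_dichotomy T N A \<gamma> L1 L2 j"
  obtains e where "e > 0" "\<And>\<gamma>'. \<bar>\<gamma>' - \<gamma>\<bar> < e \<Longrightarrow> has_dichotomy T N A \<gamma>' L1 L2 j"
proof -
  obtain \<alpha> where \<alpha>: "\<alpha> > 0" "decays_on T N A (fst j) L1 (\<gamma> - \<alpha>)" "grows_on T N A (snd j) L2 (\<gamma> + \<alpha>)"
    using assms(2) by (auto simp: has_dichotomy_iff)
  have "has_dichotomy T N A \<gamma>' L1 L2 j" if "\<bar>\<gamma>' - \<gamma>\<bar> < \<alpha>" for \<gamma>'
    unfolding has_dichotomy_iff
  proof (intro exI conjI)
    show "\<alpha> - \<bar>\<gamma>' - \<gamma>\<bar> > 0"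
      using that by simp
    show "decays_on T N A (fst j) L1 (\<gamma>' - (\<alpha> - \<bar>\<gamma>' - \<gamma>\<bar>))"
      by (rule decays_on_mono[OF assms(1) \<alpha>(2)]) simp
    show "grows_on T N A (snd j) L2 (\<gamma>' + (\<alpha> - \<bar>\<gamma>' - \<gamma>\<bar>))"
      by (rule grows_on_antimono[OF assms(1) \<alpha>(3)]) simp
  qed
  then show ?thesis
    using that \<alpha>(1) by blast
qed

text \<open>
  The recombination behind the intervals of the resolvent: decay known at \<open>\<gamma>1\<close> only gets weaker
  when \<open>\<gamma>\<close> grows, and growth known at \<open>\<gamma>2\<close> only gets weaker when \<open>\<gamma>\<close> falls.
\<close>

lemma has_dichotomy_between:
  assumes "is_norm N" "has_dichotomy T N A \<gamma>1 L1 L2 j" "has_dichotomy T N A \<gamma>2 L1' L2' j"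
    and "\<gamma>1 \<le> \<gamma>" "\<gamma> \<le> \<gamma>2"
  shows "has_dichotomy T N A \<gamma> L1 L2' j"
proof -
  obtain \<alpha> where \<alpha>: "\<alpha> > 0" "decays_on T N A (fst j) L1 (\<gamma>1 - \<alpha>)"
    using assms(2) by (auto simp: has_dichotomy_iff)
  obtain \<alpha>' where \<alpha>': "\<alpha>' > 0" "grows_on T N A (snd j) L2' (\<gamma>2 + \<alpha>')"
    using assms(3) by (auto simp: has_dichotomy_iff)
  show ?thesis
    unfolding has_dichotomy_iff
  proof (intro exI conjI)
    show "min \<alpha> \<alpha>' > 0"
      using \<alpha>(1) \<alpha>'(1) by simp
    show "decays_on T N A (fst j) L1 (\<gamma> - min \<alpha> \<alpha>')"
      by (rule decays_on_mono[OF assms(1) \<alpha>(2)]) (use assms(4) in auto)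
    show "grows_on T N A (snd j) L2' (\<gamma> + min \<alpha> \<alpha>')"
      by (rule grows_on_antimono[OF assms(1) \<alpha>'(2)]) (use assms(5) in auto)
  qed
qed

section \<open>A dichotomy determines its spaces\<close>

lemma is_norm_weighted_sol:
  "is_norm N \<Longrightarrow> N (exp r *\<^sub>R sol A n x0) = exp r * N (sol A n x0)"
  by (simp add: is_norm_scaleR)

text \<open>
  Solutions from \<open>L\<^sub>1\<close> decay faster than \<open>exp (\<gamma> * n)\<close>, while a nonzero solution from \<open>L\<^sub>2\<close>
  stays above a multiple of it; maximality of summands does the rest.
\<close>

lemma stable_space_eq_if_dichotomy:
  assumes N: "is_norm N" and T: "{0..} \<subseteq> T"
    and split: "splitting L1 L2" and dich: "has_dichotomy T N A \<gamma> L1 L2 j"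
  shows "L1 = stable_space A \<gamma>"
proof (rule splitting_summand_maximal[OF split subspace_stable_space])
  obtain \<alpha> where \<alpha>: "\<alpha> > 0" "decays_on T N A (fst j) L1 (\<gamma> - \<alpha>)" "grows_on T N A (snd j) L2 (\<gamma> + \<alpha>)"
    using dich by (auto simp: has_dichotomy_iff)
  show "L1 \<subseteq> stable_space A \<gamma>"
  proof
    fix x
    assume "x \<in> L1"
    then obtain C where C: "C > 0" "\<And>m n. m \<in> T \<Longrightarrow> n \<in> T \<Longrightarrow> m \<le> n \<Longrightarrow>
        N (sol A n x) \<le> C * exp ((\<gamma> - \<alpha>) * real_of_int (n - m)) * N (sol A m x)"
      using decays_onE[OF \<alpha>(2)] by blast
    have "\<forall>\<^sub>F n in at_top. norm (N (exp (- \<gamma> * real_of_int n) *\<^sub>R sol A n x))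
        \<le> C * N x * exp (- (\<alpha> * real_of_int n))"
      using eventually_ge_at_top[of 0]
    proof eventually_elim
      case (elim n)
      have "exp (- \<gamma> * real_of_int n) * N (sol A n x)
          \<le> exp (- \<gamma> * real_of_int n) * (C * exp ((\<gamma> - \<alpha>) * real_of_int n) * N x)"
        using C(2)[of 0 n] T elim by (intro mult_left_mono) (auto simp: sol_0)
      also have "\<dots> = C * N x * (exp (- \<gamma> * real_of_int n) * exp ((\<gamma> - \<alpha>) * real_of_int n))"
        by simp
      also have "exp (- \<gamma> * real_of_int n) * exp ((\<gamma> - \<alpha>) * real_of_int n) = exp (- (\<alpha> * real_of_int n))"
        unfolding exp_add[symmetric] by (simp add: algebra_simps)
      finally show ?case
        by (simp add: is_norm_weighted_sol[OF N] is_norm_nonneg[OF N])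
    qed
    then have "((\<lambda>n. N (exp (- \<gamma> * real_of_int n) *\<^sub>R sol A n x)) \<longlongrightarrow> 0) at_top"
      by (rule Lim_null_comparison) (intro tendsto_mult_right_zero tendsto_exp_minus_of_int \<alpha>(1))
    then show "x \<in> stable_space A \<gamma>"
      unfolding stable_space_def mem_Collect_eq by (subst tendsto_0_iff_is_norm[OF N])
  qed
  show "stable_space A \<gamma> \<inter> L2 \<subseteq> {0}"
  proof
    fix x
    assume x: "x \<in> stable_space A \<gamma> \<inter> L2"
    then obtain C where C: "C > 0" "\<And>m n. m \<in> T \<Longrightarrow> n \<in> T \<Longrightarrow> m \<le> n \<Longrightarrow>
        C * exp ((\<gamma> + \<alpha>) * real_of_int (n - m)) * N (sol A m x) \<le> N (sol A n x)"
      using grows_onE[OF \<alpha>(3)] by blast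
    have lim: "((\<lambda>n. N (exp (- \<gamma> * real_of_int n) *\<^sub>R sol A n x)) \<longlongrightarrow> 0) at_top"
      using x unfolding stable_space_def by (subst tendsto_0_iff_is_norm[OF N, symmetric]) simp
    have "\<forall>\<^sub>F n in at_top. C * N x \<le> N (exp (- \<gamma> * real_of_int n) *\<^sub>R sol A n x)"
      using eventually_ge_at_top[of 0]
    proof eventually_elim
      case (elim n)
      have "C * N x = C * 1 * N x"
        by simp
      also have "\<dots> \<le> C * exp (\<alpha> * real_of_int n) * N x"
        using C(1) \<alpha>(1) elim is_norm_nonneg[OF N]
        by (intro mult_right_mono mult_left_mono) auto
      also have "exp (\<alpha> * real_of_int n) = exp (- \<gamma> * real_of_int n) * exp ((\<gamma> + \<alpha>) * real_of_int n)"
        unfolding exp_add[symmetric] by (simp add: algebra_simps)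
      also have "C * (exp (- \<gamma> * real_of_int n) * exp ((\<gamma> + \<alpha>) * real_of_int n)) * N x
          = exp (- \<gamma> * real_of_int n) * (C * exp ((\<gamma> + \<alpha>) * real_of_int n) * N x)"
        by simp
      also have "\<dots> \<le> exp (- \<gamma> * real_of_int n) * N (sol A n x)"
        using C(2)[of 0 n] T elim by (intro mult_left_mono) (auto simp: sol_0)
      finally show ?case
        by (simp only: is_norm_weighted_sol[OF N])
    qed
    then have "C * N x \<le> 0"
      using tendsto_lowerbound[OF lim] by simp
    then have "N x = 0"
      using C(1) is_norm_nonneg[OF N, of x] by (simp add: mult_le_0_iff)
    then show "x \<in> {0}"
      using is_norm_eq_0_iff[OF N] by simp
  qed
qed

text \<open>
  For two-sided time, reading the estimates from \<open>m \<le> 0\<close> to \<open>0\<close> exchanges the roles of the two spaces.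
\<close>

lemma unstable_space_eq_if_dichotomy:
  assumes N: "is_norm N"
    and split: "splitting L1 L2" and dich: "has_dichotomy UNIV N A \<gamma> L1 L2 j"
  shows "L2 = unstable_space A \<gamma>"
proof (rule splitting_summand_maximal[OF splitting_commute[OF split] subspace_unstable_space])
  obtain \<alpha> where \<alpha>: "\<alpha> > 0" "decays_on UNIV N A (fst j) L1 (\<gamma> - \<alpha>)" "grows_on UNIV N A (snd j) L2 (\<gamma> + \<alpha>)"
    using dich by (auto simp: has_dichotomy_iff)
  show "L2 \<subseteq> unstable_space A \<gamma>"
  proof
    fix x
    assume "x \<in> L2"
    then obtain C where C: "C > 0" "\<And>m n. m \<in> UNIV \<Longrightarrow> n \<in> UNIV \<Longrightarrow> m \<le> n \<Longrightarrow>
        C * exp ((\<gamma> + \<alpha>) * real_of_int (n - m)) * N (sol A m x) \<le> N (sol A n x)"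
      using grows_onE[OF \<alpha>(3)] by blast
    have "\<forall>\<^sub>F m in at_bot. norm (N (exp (- \<gamma> * real_of_int m) *\<^sub>R sol A m x))
        \<le> N x / C * exp (\<alpha> * real_of_int m)"
      using eventually_le_at_bot[of 0]
    proof eventually_elim
      case (elim m)
      have split_exp: "exp (- \<gamma> * real_of_int m)
          = exp (\<alpha> * real_of_int m) * exp ((\<gamma> + \<alpha>) * real_of_int (0 - m))"
        unfolding exp_add[symmetric] by (simp add: algebra_simps)
      have "C * (exp (- \<gamma> * real_of_int m) * N (sol A m x))
          = exp (\<alpha> * real_of_int m) * (C * exp ((\<gamma> + \<alpha>) * real_of_int (0 - m)) * N (sol A m x))"
        unfolding split_exp by simp
      also have "\<dots> \<le> exp (\<alpha> * real_of_int m) * N x"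
        using C(2)[of m 0] elim by (intro mult_left_mono) (auto simp: sol_0)
      finally have "exp (- \<gamma> * real_of_int m) * N (sol A m x) \<le> N x / C * exp (\<alpha> * real_of_int m)"
        using C(1) by (simp add: field_simps)
      then show ?case
        by (simp add: is_norm_weighted_sol[OF N] is_norm_nonneg[OF N])
    qed
    then have "((\<lambda>n. N (exp (- \<gamma> * real_of_int n) *\<^sub>R sol A n x)) \<longlongrightarrow> 0) at_bot"
      by (rule Lim_null_comparison) (intro tendsto_mult_right_zero tendsto_exp_of_int \<alpha>(1))
    then show "x \<in> unstable_space A \<gamma>"
      unfolding unstable_space_def mem_Collect_eq by (subst tendsto_0_iff_is_norm[OF N])
  qed
  show "unstable_space A \<gamma> \<inter> L1 \<subseteq> {0}"
  proof
    fix x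
    assume x: "x \<in> unstable_space A \<gamma> \<inter> L1"
    then obtain C where C: "C > 0" "\<And>m n. m \<in> UNIV \<Longrightarrow> n \<in> UNIV \<Longrightarrow> m \<le> n \<Longrightarrow>
        N (sol A n x) \<le> C * exp ((\<gamma> - \<alpha>) * real_of_int (n - m)) * N (sol A m x)"
      using decays_onE[OF \<alpha>(2)] by blast
    have lim: "((\<lambda>n. N (exp (- \<gamma> * real_of_int n) *\<^sub>R sol A n x)) \<longlongrightarrow> 0) at_bot"
      using x unfolding unstable_space_def by (subst tendsto_0_iff_is_norm[OF N, symmetric]) simp
    have "\<forall>\<^sub>F m in at_bot. N x / C \<le> N (exp (- \<gamma> * real_of_int m) *\<^sub>R sol A m x)"
      using eventually_le_at_bot[of 0]
    proof eventually_elim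
      case (elim m)
      have split_exp: "exp ((\<gamma> - \<alpha>) * real_of_int (0 - m))
          = exp (\<alpha> * real_of_int m) * exp (- \<gamma> * real_of_int m)"
        unfolding exp_add[symmetric] by (simp add: algebra_simps)
      have "\<alpha> * real_of_int m \<le> 0"
        using \<alpha>(1) elim by (simp add: mult_le_0_iff)
      have "N x \<le> C * exp ((\<gamma> - \<alpha>) * real_of_int (0 - m)) * N (sol A m x)"
        using C(2)[of m 0] elim by (simp add: sol_0)
      also have "\<dots> = exp (\<alpha> * real_of_int m) * (C * (exp (- \<gamma> * real_of_int m) * N (sol A m x)))"
        unfolding split_exp by simp
      also have "\<dots> \<le> 1 * (C * (exp (- \<gamma> * real_of_int m) * N (sol A m x)))"
        using C(1) \<open>\<alpha> * real_of_int m \<le> 0\<close> is_norm_nonneg[OF N] by (intro mult_right_mono) auto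
      finally have "N x / C \<le> exp (- \<gamma> * real_of_int m) * N (sol A m x)"
        using C(1) by (simp add: field_simps)
      then show ?case
        by (simp only: is_norm_weighted_sol[OF N])
    qed
    then have "N x / C \<le> 0"
      using tendsto_lowerbound[OF lim] by simp
    then have "N x = 0"
      using C(1) is_norm_nonneg[OF N, of x] by (simp add: divide_le_0_iff)
    then show "x \<in> {0}"
      using is_norm_eq_0_iff[OF N] by simp
  qed
qed

section \<open>The structure of the resolvent\<close>

lemma resolventE:
  assumes "is_norm N" "{0..} \<subseteq> T" "\<gamma> \<in> resolvent T N A J"
  obtains L where "splitting (stable_space A \<gamma>) L"
    "has_dichotomy T N A \<gamma> (stable_space A \<gamma>) L (J (dim (stable_space A \<gamma>)))"
  using assms(3) stable_space_eq_if_dichotomy[OF assms(1,2)] unfolding resolvent_def by blast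

lemma resolventI:
  "splitting L1 L2 \<Longrightarrow> has_dichotomy T N A \<gamma> L1 L2 (J (dim L1)) \<Longrightarrow> \<gamma> \<in> resolvent T N A J"
  unfolding resolvent_def by blast

lemma splitting_stable_unstable:
  assumes "is_norm N" "\<gamma> \<in> resolvent UNIV N A J"
  shows "splitting (stable_space A \<gamma>) (unstable_space A \<gamma>)"
  using resolventE[OF assms(1) subset_UNIV assms(2)] unstable_space_eq_if_dichotomy[OF assms(1)]
  by metis

lemma resolvent_locally_constant:
  assumes "is_norm N" "{0..} \<subseteq> T" "\<gamma> \<in> resolvent T N A J"
  shows "\<exists>e>0. \<forall>\<gamma>'. \<bar>\<gamma>' - \<gamma>\<bar> < e \<longrightarrow> \<gamma>' \<in> resolvent T N A J \<and> stable_space A \<gamma>' = stable_space A \<gamma>"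
proof -
  obtain L where L: "splitting (stable_space A \<gamma>) L"
    "has_dichotomy T N A \<gamma> (stable_space A \<gamma>) L (J (dim (stable_space A \<gamma>)))"
    using resolventE[OF assms] .
  obtain e where e: "e > 0"
    "\<And>\<gamma>'. \<bar>\<gamma>' - \<gamma>\<bar> < e \<Longrightarrow> has_dichotomy T N A \<gamma>' (stable_space A \<gamma>) L (J (dim (stable_space A \<gamma>)))"
    using has_dichotomy_perturb[OF assms(1) L(2)] by blast
  then show ?thesis
    using resolventI[where J = J, OF L(1)] stable_space_eq_if_dichotomy[OF assms(1,2) L(1)] by metis
qed

lemma stable_space_eq_if_dim_eq:
  assumes "dim (stable_space A \<gamma>) = dim (stable_space A \<gamma>')"
  shows "stable_space A \<gamma> = stable_space A \<gamma>'"
proof (cases "\<gamma> \<le> \<gamma>'")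
  case True
  then show ?thesis
    using subspace_dim_equal[OF subspace_stable_space subspace_stable_space stable_space_mono, of \<gamma> \<gamma>' A] assms
    by simp
next
  case False
  then show ?thesis
    using subspace_dim_equal[OF subspace_stable_space subspace_stable_space stable_space_mono, of \<gamma>' \<gamma> A] assms
    by simp
qed

lemma resolvent_between:
  assumes "is_norm N" "{0..} \<subseteq> T" "\<gamma>1 \<in> resolvent T N A J" "\<gamma>2 \<in> resolvent T N A J"
    and "dim (stable_space A \<gamma>1) = dim (stable_space A \<gamma>2)" "\<gamma>1 \<le> \<gamma>" "\<gamma> \<le> \<gamma>2"
  shows "\<gamma> \<in> resolvent T N A J"
proof -
  have eq: "stable_space A \<gamma>2 = stable_space A \<gamma>1"
    using stable_space_eq_if_dim_eq[OF assms(5)] by simp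
  obtain L1 where L1: "splitting (stable_space A \<gamma>1) L1"
    "has_dichotomy T N A \<gamma>1 (stable_space A \<gamma>1) L1 (J (dim (stable_space A \<gamma>1)))"
    using resolventE[OF assms(1-3)] .
  obtain L2 where L2: "splitting (stable_space A \<gamma>1) L2"
    "has_dichotomy T N A \<gamma>2 (stable_space A \<gamma>1) L2 (J (dim (stable_space A \<gamma>1)))"
    using resolventE[OF assms(1,2,4)] unfolding eq .
  show ?thesis
    by (rule resolventI[where J = J, OF L2(1) has_dichotomy_between[OF assms(1) L1(2) L2(2) assms(6,7)]])
qed

lemma unstable_space_eq_if_dim_eq:
  assumes N: "is_norm N"
    and res: "\<gamma> \<in> resolvent UNIV N A J" "\<gamma>' \<in> resolvent UNIV N A J"
    and dim: "dim (stable_space A \<gamma>) = dim (stable_space A \<gamma>')"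
  shows "unstable_space A \<gamma> = unstable_space A \<gamma>'"
proof -
  \<comment> \<open>Two nested complements of the same stable space are equal.\<close>
  have *: "unstable_space A t = unstable_space A s"
    if "s \<le> t" "s \<in> resolvent UNIV N A J" "t \<in> resolvent UNIV N A J"
      "stable_space A s = stable_space A t" for s t
  proof (rule splitting_summand_maximal)
    show "splitting (unstable_space A t) (stable_space A t)"
      using splitting_commute[OF splitting_stable_unstable[OF N that(3)]] .
    show "unstable_space A s \<inter> stable_space A t \<subseteq> {0}"
      using splitting_stable_unstable[OF N that(2)] that(4) by (auto simp: splitting_def)
  qed (use that(1) unstable_space_antimono subspace_unstable_space in auto)
  have eq: "stable_space A \<gamma> = stable_space A \<gamma>'"
    by (rule stable_space_eq_if_dim_eq[OF dim])
  show ?thesis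
  proof (cases "\<gamma> \<le> \<gamma>'")
    case True
    show ?thesis
      by (rule *[OF True res eq, symmetric])
  next
    case False
    then have "\<gamma>' \<le> \<gamma>"
      by simp
    show ?thesis
      by (rule *[OF \<open>\<gamma>' \<le> \<gamma>\<close> res(2,1) eq[symmetric]])
  qed
qed

section \<open>Bounded growth\<close>

lemma exponential_growth_bounds:
  fixes A :: "int \<Rightarrow> real^'n^'n" and N :: "real^'n \<Rightarrow> real"
  assumes T: "T = {0..} \<or> T = UNIV" and N: "is_norm N"
    and inv: "\<forall>n\<in>T. invertible (A n)"
    and "bounded (A ` T)" "bounded ((\<lambda>n. matrix_inv (A n)) ` T)"
  obtains R where
    "\<And>m n x. m \<in> T \<Longrightarrow> m \<le> n \<Longrightarrow> N (sol A n x) \<le> exp (R * real_of_int (n - m)) * N (sol A m x)"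
    "\<And>m n x. m \<in> T \<Longrightarrow> m \<le> n \<Longrightarrow> exp (- R * real_of_int (n - m)) * N (sol A m x) \<le> N (sol A n x)"
proof -
  have "bounded (A ` T \<union> (\<lambda>n. matrix_inv (A n)) ` T)"
    using assms(4,5) by (simp only: bounded_Un)
  then obtain R where R: "\<And>M x. M \<in> A ` T \<union> (\<lambda>n. matrix_inv (A n)) ` T \<Longrightarrow> N (M *v x) \<le> exp R * N x"
    using bounded_matrices_is_norm_le[OF N] by metis
  have one_step: "N (sol A (n + 1) x) \<le> exp R * N (sol A n x)"
    "exp (- R) * N (sol A n x) \<le> N (sol A (n + 1) x)" if "n \<in> T" for n x
  proof -
    have next_eq: "sol A (n + 1) x = A n *v sol A n x"
      using inv that by (intro sol_step) auto
    then show "N (sol A (n + 1) x) \<le> exp R * N (sol A n x)"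
      using R[of "A n"] that by simp
    have "matrix_inv (A n) ** A n = mat 1"
      using inv that someI_ex[of "\<lambda>B. A n ** B = mat 1 \<and> B ** A n = mat 1"]
      by (auto simp: invertible_def matrix_inv_def)
    then have "sol A n x = matrix_inv (A n) *v sol A (n + 1) x"
      by (simp add: next_eq matrix_vector_mul_assoc)
    then have "N (sol A n x) \<le> exp R * N (sol A (n + 1) x)"
      using R[of "matrix_inv (A n)"] that by simp
    then show "exp (- R) * N (sol A n x) \<le> N (sol A (n + 1) x)"
      by (simp add: exp_minus field_simps)
  qed
  have T_up: "n \<in> T" if "m \<in> T" "m \<le> n" for m n
    using that T by auto
  show ?thesis
  proof
    fix m n x
    assume "m \<in> T" "m \<le> n"
    from \<open>m \<le> n\<close> show "N (sol A n x) \<le> exp (R * real_of_int (n - m)) * N (sol A m x)"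
    proof (induction n rule: int_ge_induct)
      case (step n)
      have "N (sol A (n + 1) x) \<le> exp R * N (sol A n x)"
        by (rule one_step(1)[OF T_up[OF \<open>m \<in> T\<close> step.hyps]])
      also have "\<dots> \<le> exp R * (exp (R * real_of_int (n - m)) * N (sol A m x))"
        using step.IH by (intro mult_left_mono) auto
      also have "\<dots> = exp (R * real_of_int (n + 1 - m)) * N (sol A m x)"
        unfolding mult.assoc[symmetric] exp_add[symmetric] by (simp add: algebra_simps)
      finally show ?case .
    qed simp
    from \<open>m \<le> n\<close> show "exp (- R * real_of_int (n - m)) * N (sol A m x) \<le> N (sol A n x)"
    proof (induction n rule: int_ge_induct)
      case (step n)
      have "exp (- R * real_of_int (n + 1 - m)) * N (sol A m x)
          = exp (- R) * (exp (- R * real_of_int (n - m)) * N (sol A m x))"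
        unfolding mult.assoc[symmetric] exp_add[symmetric] by (simp add: algebra_simps)
      also have "\<dots> \<le> exp (- R) * N (sol A n x)"
        using step.IH by (intro mult_left_mono) auto
      also have "\<dots> \<le> N (sol A (n + 1) x)"
        by (rule one_step(2)[OF T_up[OF \<open>m \<in> T\<close> step.hyps]])
      finally show ?case .
    qed simp
  qed
qed

lemma decays_on_0: "decays_on T N A 0 {0} \<beta>" if "is_norm N"
  unfolding decays_on_def subspaces_of_dim_0
  by (auto simp: sol_zero is_norm_eq_0_iff[OF that, THEN iffD2] intro!: exI[of _ 1])

lemma grows_on_0: "grows_on T N A 0 {0} \<beta>" if "is_norm N"
  unfolding grows_on_def subspaces_of_dim_0
  by (auto simp: sol_zero is_norm_eq_0_iff[OF that, THEN iffD2] intro!: exI[of _ 1])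

text \<open>
  Beyond the growth bounds one of the two spaces of the dichotomy is trivial and the bounds,
  uniform in the initial value, are its estimates on the other one. Admissibility of the first
  and last pair of uniformity dimensions makes the subspaces of the prescribed dimension cover
  that space.
\<close>

lemma resolvent_beyond_growth_bounds:
  fixes A :: "int \<Rightarrow> real^'n^'n" and N :: "real^'n \<Rightarrow> real"
  assumes T: "{0..} \<subseteq> T" and N: "is_norm N" and J: "admissible CARD('n) J"
    and upper: "\<And>m n x. m \<in> T \<Longrightarrow> m \<le> n \<Longrightarrow> N (sol A n x) \<le> exp (R * real_of_int (n - m)) * N (sol A m x)"
    and lower: "\<And>m n x. m \<in> T \<Longrightarrow> m \<le> n \<Longrightarrow> exp (- R * real_of_int (n - m)) * N (sol A m x) \<le> N (sol A n x)"
  shows "\<gamma> > R \<Longrightarrow> \<gamma> \<in> resolvent T N A J \<and> stable_space A \<gamma> = UNIV"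
    and "\<gamma> < - R \<Longrightarrow> \<gamma> \<in> resolvent T N A J \<and> stable_space A \<gamma> = {0}"
proof -
  assume \<gamma>: "\<gamma> > R"
  have "k_admissible CARD('n) CARD('n) (J CARD('n))"
    using J by (simp add: admissible_def)
  then have j: "1 \<le> fst (J CARD('n))" "fst (J CARD('n)) \<le> CARD('n)" "snd (J CARD('n)) = 0"
    by (auto simp: k_admissible_def)
  have "decays_on T N A (fst (J CARD('n))) UNIV R"
    using subspace_cover_by_dim[where 'a = "real^'n", of "fst (J CARD('n))"] j upper
    unfolding decays_on_def by (intro conjI ballI exI[of _ 1]) auto
  then have dich: "has_dichotomy T N A \<gamma> UNIV {0} (J CARD('n))"
    unfolding has_dichotomy_iff using \<gamma> j(3) grows_on_0[OF N] by (intro exI[of _ "\<gamma> - R"]) simp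
  have "\<gamma> \<in> resolvent T N A J"
    by (rule resolventI[OF splitting_UNIV_0]) (use dich in simp)
  moreover have "stable_space A \<gamma> = UNIV"
    by (rule stable_space_eq_if_dichotomy[OF N T splitting_UNIV_0 dich, symmetric])
  ultimately show "\<gamma> \<in> resolvent T N A J \<and> stable_space A \<gamma> = UNIV"
    by blast
next
  assume \<gamma>: "\<gamma> < - R"
  have "k_admissible CARD('n) 0 (J 0)"
    using J by (simp add: admissible_def)
  then have j: "fst (J 0) = 0" "1 \<le> snd (J 0)" "snd (J 0) \<le> CARD('n)"
    by (auto simp: k_admissible_def)
  have "grows_on T N A (snd (J 0)) UNIV (- R)"
    using subspace_cover_by_dim[where 'a = "real^'n", of "snd (J 0)"] j lower
    unfolding grows_on_def by (intro conjI ballI exI[of _ 1]) auto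
  then have dich: "has_dichotomy T N A \<gamma> {0} UNIV (J 0)"
    unfolding has_dichotomy_iff using \<gamma> j(1) decays_on_0[OF N] by (intro exI[of _ "- R - \<gamma>"]) simp
  have "\<gamma> \<in> resolvent T N A J"
    by (rule resolventI[OF splitting_commute[OF splitting_UNIV_0]]) (use dich in simp)
  moreover have "stable_space A \<gamma> = {0}"
    by (rule stable_space_eq_if_dichotomy[OF N T splitting_commute[OF splitting_UNIV_0] dich, symmetric])
  ultimately show "\<gamma> \<in> resolvent T N A J \<and> stable_space A \<gamma> = {0}"
    by blast
qed

section \<open>The spectral theorem\<close>

theorem theorem29:
  fixes T :: "int set"
    and N :: "real^'n \<Rightarrow> real"
    and A :: "int \<Rightarrow> real^'n^'n"
    and J :: "nat \<Rightarrow> nat \<times> nat"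
  assumes "T = {0..} \<or> T = UNIV"
    and "is_norm N"
    and "\<forall>n\<in>T. invertible (A n)"
    and "bounded (A ` T)"
    and "bounded ((\<lambda>n. matrix_inv (A n)) ` T)"
    and "admissible CARD('n) J"
  shows "\<exists>(l::nat) (a::nat \<Rightarrow> real) (b::nat \<Rightarrow> real).
    l \<in> {1..CARD('n)} \<and>
    (\<forall>k\<in>{1..l}. a k \<le> b k) \<and>
    (\<forall>k\<in>{1..<l}. b k < a (k + 1)) \<and>
    dichotomy_spectrum T N A J = (\<Union>k\<in>{1..l}. {a k..b k}) \<and>
    (\<exists>M::nat \<Rightarrow> (real^'n) set.
       M 0 = {0} \<and> M l = UNIV \<and>
       (\<forall>k\<le>l. subspace (M k)) \<and>
       (\<forall>k<l. M k \<subset> M (k + 1)) \<and>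
       (\<forall>k\<le>l. \<forall>\<gamma>\<in>gap l a b k.
          M k = {x0. ((\<lambda>n::int. exp (- \<gamma> * real_of_int n) *\<^sub>R sol A n x0) \<longlongrightarrow> 0) at_top})) \<and>
    (T = UNIV \<longrightarrow>
      (\<exists>W::nat \<Rightarrow> (real^'n) set.
         direct_sum_decomposition {1..l} W \<and>
         (\<forall>k\<in>{1..l}. \<forall>\<gamma>1\<in>gap l a b (k - 1). \<forall>\<gamma>2\<in>gap l a b k.
            W k = {x0. ((\<lambda>n::int. exp (- \<gamma>1 * real_of_int n) *\<^sub>R sol A n x0) \<longlongrightarrow> 0) at_bot \<and>
                       ((\<lambda>n::int. exp (- \<gamma>2 * real_of_int n) *\<^sub>R sol A n x0) \<longlongrightarrow> 0) at_top})))"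
proof -
  note N = assms(2)
  have T: "{0..} \<subseteq> T"
    using assms(1) by auto
  define f where "f \<gamma> = dim (stable_space A \<gamma>)" for \<gamma>
  obtain c where c:
    "\<And>m n x. m \<in> T \<Longrightarrow> m \<le> n \<Longrightarrow> N (sol A n x) \<le> exp (c * real_of_int (n - m)) * N (sol A m x)"
    "\<And>m n x. m \<in> T \<Longrightarrow> m \<le> n \<Longrightarrow> exp (- c * real_of_int (n - m)) * N (sol A m x) \<le> N (sol A n x)"
    using exponential_growth_bounds[OF assms(1-5)] by blast
  have f_le: "f t \<le> CARD('n)" for t
    using dim_subset_UNIV[of "stable_space A t"] by (simp add: f_def)
  have f_mono: "f s \<le> f t" if "s \<le> t" for s t
    unfolding f_def by (rule dim_subset[OF stable_space_mono[OF that]])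
  have loc_const: "\<exists>e>0. \<forall>s. \<bar>s - t\<bar> < e \<longrightarrow> s \<in> resolvent T N A J \<and> f s = f t"
    if "t \<in> resolvent T N A J" for t
    using resolvent_locally_constant[OF N T that] unfolding f_def by metis
  have between: "s \<in> resolvent T N A J"
    if "r \<in> resolvent T N A J" "t \<in> resolvent T N A J" "f r = f t" "r \<le> s" "s \<le> t" for r s t
    using resolvent_between[OF N T that(1,2) _ that(4,5)] that(3) by (simp add: f_def)
  have at_left: "t \<in> resolvent T N A J \<and> f t = 0" if "t < - c" for t
    using resolvent_beyond_growth_bounds(2)[OF T N assms(6) c that] by (simp add: f_def)
  have at_right: "t \<in> resolvent T N A J \<and> f t = CARD('n)" if "t > c" for t
    using resolvent_beyond_growth_bounds(1)[OF T N assms(6) c that] by (simp add: f_def)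
  have "1 \<le> CARD('n)"
    by (simp add: Suc_leI)
  obtain l a b \<kappa> where l: "l \<in> {1..CARD('n)}"
    and ab: "\<forall>k\<in>{1..l}. a k \<le> b k" "\<forall>k\<in>{1..<l}. b k < a (k + 1)"
    and spectrum: "- resolvent T N A J = (\<Union>k\<in>{1..l}. {a k..b k})"
    and gap_eq: "\<forall>k\<le>l. gap l a b k = {\<gamma> \<in> resolvent T N A J. f \<gamma> = \<kappa> k}"
    and gap_ne: "\<forall>k\<le>l. gap l a b k \<noteq> {}"
    and \<kappa>: "strict_mono_on {..l} \<kappa>" "\<kappa> 0 = 0" "\<kappa> l = CARD('n)"
    using complement_of_monotone_levels[where R = "resolvent T N A J" and f = f and d = "CARD('n)" and c = c,
        OF \<open>1 \<le> CARD('n)\<close> f_le f_mono loc_const between at_left at_right] .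
  \<comment> \<open>One representative of each gap; the stable and unstable spaces do not vary within a gap.\<close>
  define g where "g k = (SOME \<gamma>. \<gamma> \<in> gap l a b k)" for k
  have g_gap: "g k \<in> gap l a b k" if "k \<le> l" for k
    using gap_ne that by (simp add: g_def some_in_eq)
  have g: "g k \<in> resolvent T N A J" "f (g k) = \<kappa> k" if "k \<le> l" for k
    using g_gap[OF that] gap_eq that by auto
  define M where "M k = stable_space A (g k)" for k
  have M_eq: "M k = stable_space A \<gamma>" if "k \<le> l" "\<gamma> \<in> gap l a b k" for k \<gamma>
  proof -
    have "f (g k) = f \<gamma>"
      using g(2)[OF that(1)] gap_eq that by simp
    then show ?thesis
      unfolding M_def f_def by (rule stable_space_eq_if_dim_eq)
  qed
  have dim_M: "dim (M k) = \<kappa> k" if "k \<le> l" for k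
    using g(2)[OF that] by (simp add: f_def M_def)
  have sub_M: "subspace (M k)" for k
    by (simp add: M_def subspace_stable_space)
  have M_0: "M 0 = {0}"
    using dim_M[of 0] \<kappa>(2) subspace_0[OF sub_M[of 0]] by auto
  have M_l: "M l = UNIV"
    using dim_M[of l] \<kappa>(3) by (intro subspace_dim_equal sub_M) auto
  have M_strict: "M k \<subset> M (k + 1)" if "k < l" for k
  proof -
    have less: "\<kappa> k < \<kappa> (k + 1)"
      using strict_mono_onD[OF \<kappa>(1), of k "k + 1"] that by simp
    \<comment> \<open>Monotonicity of the stable spaces recovers the order of the representatives from the dimensions.\<close>
    then have "f (g k) < f (g (k + 1))"
      using g(2)[of k] g(2)[of "k + 1"] that by simp
    then have "\<not> g (k + 1) \<le> g k"
      using dim_subset[OF stable_space_mono, of "g (k + 1)" "g k" A] by (auto simp: f_def)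
    then have "M k \<subseteq> M (k + 1)"
      unfolding M_def by (intro stable_space_mono) simp
    moreover have "M k \<noteq> M (k + 1)"
      using less dim_M[of k] dim_M[of "k + 1"] that by auto
    ultimately show ?thesis
      by blast
  qed
  have filtration: "\<exists>M::nat \<Rightarrow> (real^'n) set.
       M 0 = {0} \<and> M l = UNIV \<and>
       (\<forall>k\<le>l. subspace (M k)) \<and>
       (\<forall>k<l. M k \<subset> M (k + 1)) \<and>
       (\<forall>k\<le>l. \<forall>\<gamma>\<in>gap l a b k.
          M k = {x0. ((\<lambda>n::int. exp (- \<gamma> * real_of_int n) *\<^sub>R sol A n x0) \<longlongrightarrow> 0) at_top})"
    by (intro exI[of _ M] conjI allI impI ballI M_0 M_l sub_M M_strict M_eq[unfolded stable_space_def])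
  have decomposition: "\<exists>W::nat \<Rightarrow> (real^'n) set.
         direct_sum_decomposition {1..l} W \<and>
         (\<forall>k\<in>{1..l}. \<forall>\<gamma>1\<in>gap l a b (k - 1). \<forall>\<gamma>2\<in>gap l a b k.
            W k = {x0. ((\<lambda>n::int. exp (- \<gamma>1 * real_of_int n) *\<^sub>R sol A n x0) \<longlongrightarrow> 0) at_bot \<and>
                       ((\<lambda>n::int. exp (- \<gamma>2 * real_of_int n) *\<^sub>R sol A n x0) \<longlongrightarrow> 0) at_top})"
    if Z: "T = UNIV"
  proof (intro exI conjI ballI)
    define U where "U k = unstable_space A (g k)" for k
    have U_eq: "U k = unstable_space A \<gamma>" if "k \<le> l" "\<gamma> \<in> gap l a b k" for k \<gamma>
    proof -
      have "\<gamma> \<in> resolvent UNIV N A J" "f (g k) = f \<gamma>"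
        using g(2)[OF that(1)] gap_eq that Z by simp_all
      then show ?thesis
        unfolding U_def f_def using g(1)[OF that(1)] Z
        by (intro unstable_space_eq_if_dim_eq[OF N, where J = J]) simp_all
    qed
    show "direct_sum_decomposition {1..l} (\<lambda>k. U (k - 1) \<inter> M k)"
    proof (rule direct_sum_of_opposite_filtrations[OF _ M_0 M_l])
      show "splitting (M k) (U k)" if "k \<le> l" for k
        unfolding M_def U_def by (rule splitting_stable_unstable[OF N g(1)[OF that, unfolded Z]])
      show "M k \<subseteq> M (Suc k)" if "k < l" for k
        using M_strict[OF that] by auto
    qed
    fix k \<gamma>1 \<gamma>2
    assume k: "k \<in> {1..l}" and \<gamma>: "\<gamma>1 \<in> gap l a b (k - 1)" "\<gamma>2 \<in> gap l a b k"
    have "k - 1 \<le> l"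
      using k by (simp, linarith)
    then have "U (k - 1) = unstable_space A \<gamma>1"
      by (rule U_eq[OF _ \<gamma>(1)])
    moreover have "M k = stable_space A \<gamma>2"
      by (rule M_eq[OF _ \<gamma>(2)]) (use k in simp)
    ultimately show "U (k - 1) \<inter> M k
        = {x0. ((\<lambda>n::int. exp (- \<gamma>1 * real_of_int n) *\<^sub>R sol A n x0) \<longlongrightarrow> 0) at_bot \<and>
               ((\<lambda>n::int. exp (- \<gamma>2 * real_of_int n) *\<^sub>R sol A n x0) \<longlongrightarrow> 0) at_top}"
      unfolding stable_space_def unstable_space_def by blast
  qed
  show ?thesis
    unfolding dichotomy_spectrum_def
    by (intro exI[of _ l] exI[of _ a] exI[of _ b] conjI impI l ab spectrum filtration decomposition)
qed

end
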